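(* Let $1\le k\le n-1$ and let $\lambda$ be a Young diagram fitting inside the $k\times(n-k)$ rectangle. Then in the module $M$ one has $$X_\lambda\,\mathbf 1=C^J_{w_\lambda}.$$
   Context: Let $\mathcal H$ be the Hecke algebra of $S_n$ over $\mathbb Q(v)$, generated by $T_1,\dots,T_{n-1}$ subject to the braid relations and $(T_i-v)(T_i+v^{-1})=0$; $T_w$ denotes $T_{i_1}\cdots T_{i_\ell}$ for any reduced expression $w=s_{i_1}\cdots s_{i_\ell}$. The bar involution on $\mathcal H$ is the ring involution with $\overline{v}=v^{-1}$, $\overline{T_w}=T_{w^{-1}}^{-1}$. Let $E$ be the set of sequences $\varepsilon=(\varepsilon_1,\dots,\varepsilon_n)$ of signs $\pm$ with exactly $k$ pluses; $S_n$ acts on $E$ by permuting positions ($s_i$ swaps $\varepsilon_i,\varepsilon_{i+1}$). Let $M=\bigoplus_{\varepsilon\in E}\mathbb Q(v)\varepsilon$ with $\mathcal H$-action: $T_i\varepsilon=s_i\varepsilon$ if $(\varepsilon_i,\varepsilon_{i+1})=(+,-)$; $T_i\varepsilon=-v^{-1}\varepsilon$ if $(\varepsilon_i,\varepsilon_{i+1})=(+,+)$ or $(-,-)$; $T_i\varepsilon=s_i\varepsilon+(v-v^{-1})\varepsilon$ if $(\varepsilon_i,\varepsilon_{i+1})=(-,+)$. Let $\mathbf 1=(+,\dots,+,-,\dots,-)$ ($k$ pluses then $n-k$ minuses); $M$ is generated by $\mathbf 1$ and carries the bar involution $\overline{h\mathbf 1}=\overline h\,\mathbf 1$ ($h\in\mathcal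 H$). Let $W^J$ be the minimal length coset representatives of $S_n/(S_k\times S_{n-k})$; $y\mapsto y(\mathbf 1)$ is a bijection $W^J\to E$ and $T_y\mathbf 1=y(\mathbf 1)$. The parabolic Kazhdan–Lusztig basis element $C^J_y$ ($y\in W^J$) is the unique element of $M$ with $\overline{C^J_y}=C^J_y$ and $C^J_y-y(\mathbf 1)\in\sum_{\varepsilon\in E}v\mathbb Z[v]\,\varepsilon$. For a Young diagram $\lambda=(\lambda_1\ge\dots\ge\lambda_\ell>0)$ with $\ell\le k$, $\lambda_1\le n-k$, with boxes $(i,j)$, $1\le j\le\lambda_i$: $w_\lambda=P_\ell\cdots P_1$ where $P_i=s_{k+\lambda_i-i}s_{k+\lambda_i-i-1}\cdots s_{k+1-i}$. Define positive integers $r_{ij}$ for $(i,j)\in\lambda$ recursively by $r_{ij}=\max(r_{i,j+1},r_{i+1,j})+1$, where $r_{ij}=0$ if $(i,j)\notin\lambda$. With $[r]=(v^r-v^{-r})/(v-v^{-1})$, define $X_\lambda=Q_\ell Q_{\ell-1}\cdots Q_1\in\mathcal H$, where $Q_i=\prod_{j=\lambda_i}^{1}\Bigl(T_{k+j-i}-\frac{v^{r_{ij}}}{[r_{ij}]}\Bigr)$ with factors ordered from $j=\lambda_i$ (leftmost) to $j=1$ (rightmost), i.e. the same ordering of boxes as in $w_\lambda$. *)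

theory Defs
  imports "HOL-Computational_Algebra.Polynomial" "HOL-Computational_Algebra.Fraction_Field"
begin

type_synonym qv = "rat poly fract"

definition vv :: qv where "vv = Fract [:0, 1:] 1"

definition const_qv :: "rat \<Rightarrow> qv" where "const_qv c = Fract [:c:] 1"

definition ev_inv :: "rat poly \<Rightarrow> qv" where
  "ev_inv p = poly (map_poly const_qv p) (inverse vv)"

text \<open>Bar involution on Q(v): the field automorphism fixing Q with v mapped to v^{-1}.\<close>
definition qbar :: "qv \<Rightarrow> qv" where
  "qbar x = (THE y. \<exists>a b. b \<noteq> 0 \<and> x = Fract a b \<and> y = ev_inv a / ev_inv b)"

definition of_ipoly :: "int poly \<Rightarrow> qv" where
  "of_ipoly p = Fract (map_poly of_int p) 1"

definition in_vZv :: "qv \<Rightarrow> bool" where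
  "in_vZv x \<longleftrightarrow> (\<exists>p. coeff p 0 = 0 \<and> x = of_ipoly p)"

definition qint :: "nat \<Rightarrow> qv" where
  "qint r = (vv ^ r - inverse vv ^ r) / (vv - inverse vv)"

text \<open>A sign sequence eps = (eps_1,...,eps_n) is a bool list of length n
  (True = +, False = -); eps_i is the list entry at index i - 1.\<close>

definition Eset :: "nat \<Rightarrow> nat \<Rightarrow> bool list set" where
  "Eset n k = {xs. length xs = n \<and> count_list xs True = k}"

definition swp :: "nat \<Rightarrow> bool list \<Rightarrow> bool list" where
  "swp i xs = xs[i - 1 := xs ! i, i := xs ! (i - 1)]"

text \<open>Action of a word s_{a_1} ... s_{a_m} (given as the list [a_1,...,a_m]) on sign
  sequences: the rightmost letter acts first.\<close>
definition perm_act :: "nat list \<Rightarrow> bool list \<Rightarrow> bool list" where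
  "perm_act w xs = foldr swp w xs"

definition one_seq :: "nat \<Rightarrow> nat \<Rightarrow> bool list" where
  "one_seq n k = replicate k True @ replicate (n - k) False"

text \<open>Elements of M are coefficient functions on sign sequences, supported on E.\<close>
type_synonym vec = "bool list \<Rightarrow> qv"

definition inM :: "nat \<Rightarrow> nat \<Rightarrow> vec \<Rightarrow> bool" where
  "inM n k m \<longleftrightarrow> (\<forall>d. d \<notin> Eset n k \<longrightarrow> m d = 0)"

definition basisv :: "bool list \<Rightarrow> vec" where
  "basisv e = (\<lambda>d. if d = e then 1 else 0)"

definition Tcoef :: "nat \<Rightarrow> bool list \<Rightarrow> bool list \<Rightarrow> qv" where
  "Tcoef i e d =
     (if e ! (i - 1) \<and> \<not> e ! i then (if d = swp i e then 1 else 0)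
      else if e ! (i - 1) = e ! i then (if d = e then - inverse vv else 0)
      else (if d = swp i e then 1 else 0) + (if d = e then vv - inverse vv else 0))"

definition Tact :: "nat \<Rightarrow> nat \<Rightarrow> nat \<Rightarrow> vec \<Rightarrow> vec" where
  "Tact n k i m = (\<lambda>d. \<Sum>e\<in>Eset n k. m e * Tcoef i e d)"

definition Tinv_act :: "nat \<Rightarrow> nat \<Rightarrow> nat \<Rightarrow> vec \<Rightarrow> vec" where
  "Tinv_act n k i m = (\<lambda>d. Tact n k i m d - (vv - inverse vv) * m d)"

text \<open>An element h of H is written as a Q(v)-linear combination of monomials
  T_{a_1} ... T_{a_m} in the generators, represented as a list of pairs
  (coefficient, [a_1,...,a_m]). The Hecke algebra is the quotient of this free
  algebra by the braid and quadratic relations; since M is an H-module, the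
  action factors through the quotient.\<close>
type_synonym hword = "(qv \<times> nat list) list"

definition valid_h :: "nat \<Rightarrow> hword \<Rightarrow> bool" where
  "valid_h n h \<longleftrightarrow> (\<forall>(c, w) \<in> set h. set w \<subseteq> {1..<n})"

fun word_act :: "nat \<Rightarrow> nat \<Rightarrow> nat list \<Rightarrow> vec \<Rightarrow> vec" where
  "word_act n k [] m = m"
| "word_act n k (i # w) m = Tact n k i (word_act n k w m)"

text \<open>Action of the bar image of a monomial: bar(T_{a_1} ... T_{a_m}) = T_{a_1}^{-1} ... T_{a_m}^{-1}.\<close>
fun word_bar_act :: "nat \<Rightarrow> nat \<Rightarrow> nat list \<Rightarrow> vec \<Rightarrow> vec" where
  "word_bar_act n k [] m = m"
| "word_bar_act n k (i # w) m = Tinv_act n k i (word_bar_act n k w m)"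

definition h_act :: "nat \<Rightarrow> nat \<Rightarrow> hword \<Rightarrow> vec \<Rightarrow> vec" where
  "h_act n k h m = (\<lambda>d. \<Sum>(c, w)\<leftarrow>h. c * word_act n k w m d)"

definition hbar_act :: "nat \<Rightarrow> nat \<Rightarrow> hword \<Rightarrow> vec \<Rightarrow> vec" where
  "hbar_act n k h m = (\<lambda>d. \<Sum>(c, w)\<leftarrow>h. qbar c * word_bar_act n k w m d)"

definition barM :: "nat \<Rightarrow> nat \<Rightarrow> vec \<Rightarrow> vec" where
  "barM n k m = (THE m'. \<exists>h. valid_h n h \<and> m = h_act n k h (basisv (one_seq n k))
                           \<and> m' = hbar_act n k h (basisv (one_seq n k)))"

text \<open>Parabolic Kazhdan--Lusztig basis element C^J_y, y given by a word for it.\<close>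
definition CJ :: "nat \<Rightarrow> nat \<Rightarrow> nat list \<Rightarrow> vec" where
  "CJ n k y = (THE m. inM n k m \<and> barM n k m = m \<and>
     (\<forall>e\<in>Eset n k. in_vZv (m e - basisv (perm_act y (one_seq n k)) e)))"

text \<open>lambda = (lambda_1 \<ge> ... \<ge> lambda_l > 0) as a list; lambda_i is the entry at index i-1.\<close>
definition young :: "nat list \<Rightarrow> bool" where
  "young lam \<longleftrightarrow> sorted_wrt (\<ge>) lam \<and> (\<forall>x\<in>set lam. 0 < x)"

definition fits :: "nat \<Rightarrow> nat \<Rightarrow> nat list \<Rightarrow> bool" where
  "fits n k lam \<longleftrightarrow> length lam \<le> k \<and> (\<forall>x\<in>set lam. x \<le> n - k)"

definition in_diag :: "nat list \<Rightarrow> nat \<Rightarrow> nat \<Rightarrow> bool" where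
  "in_diag lam i j \<longleftrightarrow> 1 \<le> i \<and> i \<le> length lam \<and> 1 \<le> j \<and> j \<le> lam ! (i - 1)"

function rr :: "nat list \<Rightarrow> nat \<Rightarrow> nat \<Rightarrow> nat" where
  "rr lam i j = (if in_diag lam i j then max (rr lam i (j + 1)) (rr lam (i + 1) j) + 1 else 0)"
  by pat_completeness auto
termination
proof (relation "measure (\<lambda>(lam, i, j). length lam + sum_list lam + 2 - (i + j))", goal_cases)
  case 1 then show ?case by simp
next
  case (2 lam i j)
  then have "lam ! (i - 1) \<le> sum_list lam"
    by (auto simp: in_diag_def intro!: elem_le_sum_list)
  with 2 show ?case by (auto simp: in_diag_def)
next
  case (3 lam i j)
  then have "lam ! (i - 1) \<le> sum_list lam"
    by (auto simp: in_diag_def intro!: elem_le_sum_list)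
  with 3 show ?case by (auto simp: in_diag_def)
qed

declare rr.simps [simp del]

text \<open>Boxes listed in the order in which the factors act on 1 (rightmost factor first):
  rows i = 1,...,l, and within row i, columns j = 1,...,lambda_i.\<close>
definition boxes :: "nat list \<Rightarrow> (nat \<times> nat) list" where
  "boxes lam = concat (map (\<lambda>i. map (\<lambda>j. (i, j)) [1..<lam ! (i - 1) + 1]) [1..<length lam + 1])"

text \<open>w_lambda = P_l ... P_1 as a word (left-to-right product order).\<close>
definition w_lam :: "nat \<Rightarrow> nat list \<Rightarrow> nat list" where
  "w_lam k lam = rev (map (\<lambda>(i, j). k + j - i) (boxes lam))"

definition X_act :: "nat \<Rightarrow> nat \<Rightarrow> nat list \<Rightarrow> vec \<Rightarrow> vec" where
  "X_act n k lam m = fold (\<lambda>(i, j) x. (\<lambda>d. Tact n k (k + j - i) x d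
                        - (vv ^ rr lam i j / qint (rr lam i j)) * x d)) (boxes lam) m"

end

theory Submission
  imports Defs
begin

text \<open>
  Put U = T + 1/v. Then U is a Temperley-Lieb generator: it factors through the cap that contracts
  two adjacent positions, and each factor of X is U - [r+1]/[r]. Capping X 1 at an outer corner of
  the Young diagram gives X 1 for the diagram with the row and the column at that corner deleted,
  and capping at any other place gives 0. Since the cap sends m to the function
  m(A + - B) + v m(A - + B) of AB, the coefficient of X 1 at A + - B is a coefficient for a smaller
  diagram minus v times the coefficient at A - + B, so by induction all coefficients lie in
  \<delta> + v Z[v]. The factors are fixed by the bar involution because [r+1]/[r] is.

  That the bar map of M is well defined follows by writing it as the action of the longest element
  followed by the reversal of positions and coefficientwise conjugation.
\<close>

text \<open>The parameter of a box depends on the boxes beyond it. When an outer box is taken away,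
  the remaining factors keep the parameters of the larger diagram, so they are not the product for
  the smaller diagram and an induction over boxes does not close. The statements about caps are
  therefore made for diagrams with arbitrary labels along the boundary, under inequalities between
  neighbouring labels that survive the removal of a box. Only three facts about [r+1]/[r] enter. For
  r = 1 it is [2], the value of a closed loop, so a cap kills a factor with r = 1 at its own place.
  The recurrence [2][r+1] = [r] + [r+2] makes neighbouring factors with consecutive parameters
  cancel under a cap. Finally, the ratio is bar invariant. Uniqueness of the Kazhdan-Lusztig element
  is the usual argument: bar is unitriangular for the number of inversions, and 0 is the only bar
  invariant element of v Z[v].\<close>

section \<open>The bar involution of the base field\<close>

lemma const_qv_hom:
  "const_qv 0 = 0" "const_qv 1 = 1" "const_qv (a + b) = const_qv a + const_qv b"
  "const_qv (a * b) = const_qv a * const_qv b"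
  by (simp_all add: const_qv_def Zero_fract_def One_fract_def one_pCons mult.commute)

lemma vv_neq_0 [simp]: "vv \<noteq> 0"
  by (simp add: vv_def Zero_fract_def eq_fract)

text \<open>Evaluation at a free point: one set of homomorphism laws serves v, where it embeds the
  polynomials, and 1/v, where it is \<open>ev_inv\<close>.\<close>

definition qeval :: "qv \<Rightarrow> rat poly \<Rightarrow> qv" where
  "qeval x p = poly (map_poly const_qv p) x"

lemma qeval_pCons: "qeval x (pCons a p) = const_qv a + x * qeval x p"
  by (cases "a = 0 \<and> p = 0") (auto simp: qeval_def map_poly_pCons const_qv_hom)

lemma qeval_0: "qeval x 0 = 0"
  by (simp add: qeval_def)

lemma qeval_add: "qeval x (p + q) = qeval x p + qeval x q"
  by (induction p q rule: poly_induct2) (simp_all add: qeval_0 qeval_pCons const_qv_hom algebra_simps)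

lemma qeval_smult: "qeval x (smult a p) = const_qv a * qeval x p"
  by (induction p) (simp_all add: qeval_0 qeval_pCons const_qv_hom algebra_simps)

lemma qeval_mult: "qeval x (p * q) = qeval x p * qeval x q"
  by (induction p) (simp_all add: qeval_0 qeval_pCons qeval_add qeval_smult const_qv_hom algebra_simps)

lemma qeval_1: "qeval x 1 = 1"
  by (simp add: one_pCons qeval_pCons qeval_0 const_qv_hom)

lemma qeval_vv: "qeval vv p = Fract p 1"
proof (induction p)
  case 0 then show ?case by (simp add: qeval_0 Zero_fract_def)
next
  case (pCons a p)
  have "const_qv a + vv * Fract p 1 = Fract ([:a:] + [:0, 1:] * p) 1"
    by (simp add: const_qv_def vv_def)
  with pCons show ?case by (simp add: qeval_pCons)
qed

lemma ev_inv_eq: "ev_inv p = qeval (inverse vv) p"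
  by (simp add: ev_inv_def qeval_def)

lemma const_qv_eq_0: "const_qv a = 0 \<longleftrightarrow> a = 0"
  by (simp add: const_qv_def Zero_fract_def eq_fract)

text \<open>Clearing denominators reduces the injectivity of \<open>ev_inv\<close> and the degree
  argument in \<open>qbar_fixed_in_vZv\<close> to statements about polynomials.\<close>

lemma ev_inv_reflect: "vv ^ degree p * ev_inv p = Fract (reflect_poly p) 1"
proof -
  have d: "degree (map_poly const_qv p) = degree p"
    by (rule degree_map_poly) (simp add: const_qv_eq_0)
  have "reflect_poly (map_poly const_qv p) = map_poly const_qv (reflect_poly p)"
    by (rule poly_eqI) (simp add: coeff_reflect_poly d coeff_map_poly const_qv_hom)
  then show ?thesis
    using poly_reflect_poly_nz[of vv "map_poly const_qv p"]
    by (simp add: d ev_inv_eq qeval_def flip: qeval_vv)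
qed

lemma Fract_one_inject: "Fract p 1 = Fract q 1 \<longleftrightarrow> p = (q :: rat poly)"
  by (simp add: eq_fract)

lemma ev_inv_eq_0: "ev_inv p = 0 \<longleftrightarrow> p = 0"
proof
  assume "ev_inv p = 0"
  then have "Fract (reflect_poly p) 1 = Fract 0 1"
    using ev_inv_reflect[of p] by (simp flip: Zero_fract_def)
  then show "p = 0" by (simp add: Fract_one_inject)
qed (simp add: ev_inv_eq qeval_0)

lemma qbar_Fract:
  assumes "b \<noteq> 0" shows "qbar (Fract a b) = ev_inv a / ev_inv b"
  unfolding qbar_def
proof (rule the_equality)
  show "\<exists>a' b'. b' \<noteq> 0 \<and> Fract a b = Fract a' b' \<and> ev_inv a / ev_inv b = ev_inv a' / ev_inv b'"
    using assms by blast
next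
  fix y assume "\<exists>a' b'. b' \<noteq> 0 \<and> Fract a b = Fract a' b' \<and> y = ev_inv a' / ev_inv b'"
  then obtain a' b' where *: "b' \<noteq> 0" "Fract a b = Fract a' b'" "y = ev_inv a' / ev_inv b'"
    by blast
  then have "a * b' = a' * b" using assms by (simp add: eq_fract)
  then have "ev_inv a * ev_inv b' = ev_inv a' * ev_inv b"
    by (metis ev_inv_eq qeval_mult)
  with * assms show "y = ev_inv a / ev_inv b"
    by (simp add: frac_eq_eq ev_inv_eq_0)
qed

lemma qbar_add: "qbar (x + y) = qbar x + qbar y"
proof (cases x; cases y)
  fix a b c d :: "rat poly"
  assume "x = Fract a b" "b \<noteq> 0" "y = Fract c d" "d \<noteq> 0"
  then show ?thesis
    using ev_inv_eq_0[of b] ev_inv_eq_0[of d]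
    by (simp add: qbar_Fract ev_inv_eq qeval_add qeval_mult add_frac_eq)
qed

lemma qbar_mult: "qbar (x * y) = qbar x * qbar y"
proof (cases x; cases y)
  fix a b c d :: "rat poly"
  assume "x = Fract a b" "b \<noteq> 0" "y = Fract c d" "d \<noteq> 0"
  then show ?thesis
    by (simp add: qbar_Fract ev_inv_eq qeval_mult)
qed

lemma qbar_0 [simp]: "qbar 0 = 0"
  using qbar_add[of 0 0] by simp

lemma qbar_1 [simp]: "qbar 1 = 1"
  by (simp add: One_fract_def qbar_Fract ev_inv_eq qeval_1)

lemma qbar_minus: "qbar (- x) = - qbar x"
  using qbar_add[of x "- x"] by (simp add: eq_neg_iff_add_eq_0 add.commute)

lemma qbar_diff: "qbar (x - y) = qbar x - qbar y"
  using qbar_add[of x "- y"] by (simp add: qbar_minus)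

lemma qbar_vv [simp]: "qbar vv = inverse vv"
  unfolding vv_def
  by (simp add: qbar_Fract ev_inv_eq qeval_pCons qeval_0 qeval_1 const_qv_hom vv_def)

lemma qbar_inverse: "qbar (inverse x) = inverse (qbar x)"
proof (cases "x = 0")
  case False
  then have "qbar x * qbar (inverse x) = 1"
    by (simp flip: qbar_mult)
  then show ?thesis by (metis inverse_unique)
qed simp

lemma qbar_divide: "qbar (x / y) = qbar x / qbar y"
  by (simp add: divide_inverse qbar_mult qbar_inverse)

lemma qbar_power: "qbar (x ^ n) = qbar x ^ n"
  by (induction n) (simp_all add: qbar_mult)

section \<open>The lattice v Z[v]\<close>

lemma of_ipoly_hom:
  "of_ipoly 0 = 0" "of_ipoly 1 = 1" "of_ipoly (p + q) = of_ipoly p + of_ipoly q"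
  "of_ipoly (- p) = - of_ipoly p"
  "of_ipoly (pCons 0 p) = vv * of_ipoly p"
proof -
  show 0: "of_ipoly 0 = 0" by (simp add: of_ipoly_def Zero_fract_def)
  show "of_ipoly 1 = 1" by (simp add: of_ipoly_def One_fract_def map_poly_1 flip: one_pCons)
  show add: "of_ipoly (p + q) = of_ipoly p + of_ipoly q" for p q
  proof -
    have "map_poly of_int (p + q) = map_poly of_int p + (map_poly of_int q :: rat poly)"
      by (rule poly_eqI) (simp add: coeff_map_poly)
    then show ?thesis by (simp add: of_ipoly_def)
  qed
  show "of_ipoly (- p) = - of_ipoly p"
    using add[of p "- p"] 0 by (simp add: eq_neg_iff_add_eq_0 add.commute)
  have "map_poly of_int (pCons 0 p) = [:0, 1:] * (map_poly of_int p :: rat poly)"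
    by (cases "p = 0") (simp_all add: map_poly_pCons)
  then show "of_ipoly (pCons 0 p) = vv * of_ipoly p"
    by (simp add: of_ipoly_def vv_def)
qed

lemma in_vZv_0: "in_vZv 0"
  unfolding in_vZv_def by (rule exI[of _ 0]) (simp add: of_ipoly_hom)

lemma in_vZv_diff: "in_vZv x \<Longrightarrow> in_vZv y \<Longrightarrow> in_vZv (x - y)"
  unfolding in_vZv_def
  by (metis (no_types, opaque_lifting) add.right_neutral coeff_add coeff_minus minus_zero of_ipoly_hom(3,4) uminus_add_conv_diff add.commute)

text \<open>Here \<delta> is a coefficient of a basis vector, so x is in Z[v], and the factor v that
  comes with a cap moves it into v Z[v].\<close>

lemma in_vZv_vv_mult:
  assumes "in_vZv (x - \<delta>)" "\<delta> = 0 \<or> \<delta> = 1"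
  shows "in_vZv (vv * x)"
proof -
  obtain p where p: "x - \<delta> = of_ipoly p" using assms(1) by (auto simp: in_vZv_def)
  obtain q where q: "\<delta> = of_ipoly q" using assms(2) by (metis of_ipoly_hom(1,2))
  have "vv * x = of_ipoly (pCons 0 (p + q))"
    unfolding of_ipoly_hom using p q by (simp add: algebra_simps)
  then show ?thesis unfolding in_vZv_def by (metis coeff_pCons_0)
qed

lemma vv_power: "vv ^ m = Fract (monom 1 m) 1"
  by (induction m) (simp_all add: One_fract_def vv_def monom_Suc monom_0 flip: one_pCons)

lemma qbar_fixed_in_vZv:
  assumes "in_vZv x" "qbar x = x" shows "x = 0"
proof -
  obtain p where p: "coeff p 0 = 0" "x = of_ipoly p" using assms(1) by (auto simp: in_vZv_def)
  define P :: "rat poly" where "P = map_poly of_int p"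
  have x: "x = Fract P 1" by (simp add: p P_def of_ipoly_def)
  have "Fract P 1 = ev_inv P" using assms(2) by (simp add: x qbar_Fract ev_inv_eq qeval_1)
  then have "Fract (monom 1 (degree P)) 1 * Fract P 1 = Fract (reflect_poly P) 1"
    using ev_inv_reflect[of P] by (simp add: vv_power)
  then have "Fract (monom 1 (degree P) * P) 1 = Fract (reflect_poly P) 1" by simp
  then have eq: "monom 1 (degree P) * P = reflect_poly P" by (simp only: Fract_one_inject)
  have "P = 0"
  proof (rule ccontr)
    assume "P \<noteq> 0"
    \<comment> \<open>The left side of \<open>eq\<close> has twice the degree of P, while reversing
      the coefficients cannot raise the degree.\<close>
    then have "degree P + degree P = degree (reflect_poly P)"
      by (simp add: degree_mult_eq degree_monom_eq flip: eq)
    then have "degree P = 0" using degree_reflect_poly_le[of P] by simp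
    moreover have "coeff P 0 = 0" by (simp add: P_def coeff_map_poly p)
    ultimately show False using \<open>P \<noteq> 0\<close> by (metis leading_coeff_0_iff)
  qed
  then show ?thesis by (simp add: x Zero_fract_def)
qed

section \<open>Ratios of quantum integers\<close>

lemma vv_power_neq_1:
  assumes "0 < m" shows "vv ^ m \<noteq> 1"
proof
  assume "vv ^ m = 1"
  then have "monom 1 m = (1 :: rat poly)" by (simp add: vv_power One_fract_def Fract_one_inject)
  then have "degree (monom (1::rat) m) = 0" by simp
  then show False using assms by (simp add: degree_monom_eq)
qed

text \<open>In quantum integers, spec r = [r+1]/[r].\<close>

definition spec :: "nat \<Rightarrow> qv" where
  "spec r = inverse vv + vv ^ r / qint r"

lemma spec_eq:
  assumes "0 < r"
  shows "spec r = (vv ^ (2 * r + 2) - 1) / (vv * (vv ^ (2 * r) - 1))"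
proof -
  define a where "a = vv ^ r"
  have a: "a \<noteq> 0" "a * a - 1 \<noteq> 0" "vv * vv - 1 \<noteq> 0" "vv \<noteq> 0"
    using vv_power_neq_1[of "2 * r"] vv_power_neq_1[of 2] assms
    by (simp_all add: a_def power_mult_distrib mult_2 power_add power2_eq_square)
  have a1: "a - inverse a = (a * a - 1) / a" "vv - inverse vv = (vv * vv - 1) / vv"
    using a by (simp_all add: field_simps)
  have "spec r = inverse vv + a * (vv - inverse vv) / (a - inverse a)"
    by (simp add: spec_def qint_def a_def power_inverse)
  also have "\<dots> = (a * a * (vv * vv) - 1) / (vv * (a * a - 1))"
    unfolding a1 using a by (simp add: divide_simps) (simp add: algebra_simps)
  also have "\<dots> = (vv ^ (2 * r + 2) - 1) / (vv * (vv ^ (2 * r) - 1))"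
  proof -
    have "vv ^ (2 * r) = a * a" "vv ^ (2 * r + 2) = a * a * (vv * vv)"
      by (simp_all only: a_def mult_2 power_add power2_eq_square)
    then show ?thesis by simp
  qed
  finally show ?thesis .
qed

lemma spec_1: "spec (Suc 0) = vv + inverse vv"
proof -
  have a: "vv * vv - 1 \<noteq> 0" "vv \<noteq> 0" using vv_power_neq_1[of 2] by (simp_all add: power2_eq_square)
  have "vv ^ 4 - 1 = (vv * vv - 1) * (vv * vv + 1)"
    by (simp add: algebra_simps numeral_eq_Suc)
  then have "spec (Suc 0) = (vv * vv + 1) / vv"
    using a by (simp add: spec_eq power2_eq_square)
  then show ?thesis by (simp add: field_simps)
qed

text \<open>This is the recurrence [2][r+1] = [r] + [r+2] after division by [r].\<close>

lemma spec_Suc: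
  assumes "0 < r"
  shows "spec r * (vv + inverse vv - spec (Suc r)) = 1"
proof -
  define w where "w = vv ^ (2 * r)"
  have w: "w - 1 \<noteq> 0" "w * (vv * vv) - 1 \<noteq> 0" "vv \<noteq> 0"
    using vv_power_neq_1[of "2 * r"] vv_power_neq_1[of "2 * r + 2"] assms
    by (simp_all add: w_def power_add power2_eq_square mult_ac)
  have 1: "spec r = (w * (vv * vv) - 1) / (vv * (w - 1))"
    using assms by (simp add: spec_eq w_def power_add power2_eq_square mult_ac)
  have 2: "spec (Suc r) = (w * (vv * vv) * (vv * vv) - 1) / (vv * (w * (vv * vv) - 1))"
    by (simp add: spec_eq w_def power_add power2_eq_square mult_ac)
  have "vv + inverse vv - spec (Suc r) = vv * (w - 1) / (w * (vv * vv) - 1)"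
    unfolding 2 using w by (simp add: divide_simps) (simp add: algebra_simps)
  then show ?thesis unfolding 1 using w by simp
qed

lemma qbar_spec:
  assumes "0 < r" shows "qbar (spec r) = spec r"
proof -
  have "qbar (qint r) = qint r"
    unfolding qint_def using minus_divide_divide[of "vv ^ r - inverse vv ^ r" "vv - inverse vv"]
    by (simp add: qbar_divide qbar_diff qbar_power qbar_inverse)
  moreover have "qint r \<noteq> 0"
  proof -
    have "vv ^ r * vv ^ r \<noteq> 1" "vv * vv \<noteq> 1"
      using vv_power_neq_1[of "r + r"] vv_power_neq_1[of 2] assms
      by (simp_all only: power_add power2_eq_square) simp_all
    then show ?thesis unfolding qint_def by (simp add: field_simps)
  qed
  \<comment> \<open>Bar changes \<open>spec r\<close> by (v - 1/v) - (v^r - v^-r)/[r], which is 0 by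
    the definition of [r].\<close>
  moreover from this have "vv ^ r / qint r - inverse vv ^ r / qint r = vv - inverse vv"
    unfolding diff_divide_distrib[symmetric] by (simp add: qint_def nonzero_divide_eq_eq)
  ultimately show ?thesis
    unfolding spec_def by (simp add: qbar_add qbar_divide qbar_power qbar_inverse algebra_simps)
qed

section \<open>Caps and Temperley-Lieb generators\<close>

lemma vv_inverse_cancel [simp]: "vv * (inverse vv * x) = x" "inverse vv * (vv * x) = x"
  by (simp_all flip: mult.assoc)

text \<open>Positions count from 0, so that tlgen p is T + 1/v for the generator T with index p + 1.\<close>

fun cap :: "nat \<Rightarrow> vec \<Rightarrow> vec" where
  "cap 0 m d = m (True # False # d) + vv * m (False # True # d)"
| "cap (Suc p) m [] = 0"
| "cap (Suc p) m (x # d) = cap p (\<lambda>e. m (x # e)) d"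

text \<open>The cap followed by the cup with entry 1/v at + - and 1 at - +; closing the two gives
  1/v + v = [2].\<close>

fun tlgen :: "nat \<Rightarrow> vec \<Rightarrow> vec" where
  "tlgen 0 m (x # y # d) = (if x = y then 0
     else (if x then inverse vv else 1) * (m (True # False # d) + vv * m (False # True # d)))"
| "tlgen (Suc p) m (x # d) = tlgen p (\<lambda>e. m (x # e)) d"
| "tlgen _ _ _ = 0"

lemma tlgen_Nil [simp]: "tlgen p m [] = 0"
  by (cases p) simp_all

lemma cap_lin:
  "cap p (\<lambda>e. f e + h e) d = cap p f d + cap p h d"
  "cap p (\<lambda>e. f e - h e) d = cap p f d - cap p h d"
  "cap p (\<lambda>e. c * f e) d = c * cap p f d"
  "cap p (\<lambda>e. 0) d = 0"
  by (induction p f d arbitrary: h rule: cap.induct) (simp_all, simp_all add: algebra_simps)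

lemma tlgen_lin:
  "tlgen p (\<lambda>e. f e + h e) d = tlgen p f d + tlgen p h d"
  "tlgen p (\<lambda>e. f e - h e) d = tlgen p f d - tlgen p h d"
  "tlgen p (\<lambda>e. c * f e) d = c * tlgen p f d"
  "tlgen p (\<lambda>e. 0) d = 0"
  by (induction p f d arbitrary: h rule: tlgen.induct) (simp_all, simp_all add: algebra_simps)

lemma cap_append: "cap (length A) m (A @ B) = m (A @ True # False # B) + vv * m (A @ False # True # B)"
  by (induction A arbitrary: m) simp_all

lemma tlgen_append: "tlgen (length A) m (A @ x # y # B) = (if x = y then 0
     else (if x then inverse vv else 1) * (m (A @ True # False # B) + vv * m (A @ False # True # B)))"
  by (induction A arbitrary: m) simp_all

lemma tlgen_short: "length d < p + 2 \<Longrightarrow> tlgen p m d = 0"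
  by (induction p m d rule: tlgen.induct) simp_all

lemma cap_short: "length d < p \<Longrightarrow> cap p m d = 0"
  by (induction p m d rule: cap.induct) simp_all

lemma cap_tlgen_same: "cap p (tlgen p m) d = (vv + inverse vv) * cap p m d"
  by (induction p m d rule: cap.induct) (simp_all add: algebra_simps)

text \<open>A zigzag of a cap and a neighbouring cup straightens, leaving only the cap of the
  generator.\<close>

lemma cap_tlgen_above: "cap p (tlgen (Suc p) m) d = cap (Suc p) m d"
proof (induction p m d rule: cap.induct)
  case (1 m d)
  then show ?case by (cases d) (auto simp: distrib_left mult.left_commute)
qed simp_all

text \<open>The bound matters: at a sequence of length p the left side is 0 by default, while the
  right side is a genuine contraction.\<close>

lemma cap_tlgen_below: "p < length d \<Longrightarrow> cap (Suc p) (tlgen p m) d = cap p m d"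
proof (induction p m d rule: cap.induct)
  case (1 m d)
  then show ?case by (cases d) (auto simp: distrib_left mult.left_commute)
qed simp_all

text \<open>The index of the generator drops by two because the cap deletes two positions to its
  left.\<close>

lemma cap_tlgen_far_above:
  "p \<le> q \<Longrightarrow> cap p (tlgen (q + 2) m) d = tlgen q (cap p m) d"
proof (induction p m d arbitrary: q rule: cap.induct)
  case (1 m d)
  have "(cap 0 m) = (\<lambda>e. m (True # False # e) + vv * m (False # True # e))"
    by (rule ext) simp
  then show ?case by (simp add: tlgen_lin)
next
  case (3 p m x d)
  then obtain q' where q: "q = Suc q'" by (cases q) auto
  with 3 show ?case by simp
qed simp_all

lemma cap_tlgen_far_below:
  "q + 2 \<le> p \<Longrightarrow> cap p (tlgen q m) d = tlgen q (cap p m) d"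
proof (induction q arbitrary: p m d)
  case 0
  then obtain p' where p: "p = Suc (Suc p')" by (metis add_0 add_2_eq_Suc le_Suc_ex)
  show ?case
  proof (cases "length d < 2")
    case True
    then show ?thesis using 0 by (simp add: cap_short tlgen_short)
  next
    case False
    then obtain x y d' where d: "d = x # y # d'" by (cases d rule: remdups_adj.cases) auto
    have "cap p' (\<lambda>e. (if x = y then 0 else (if x then inverse vv else 1) *
          (m (True # False # e) + vv * m (False # True # e)))) d' =
        (if x = y then 0 else (if x then inverse vv else 1) *
          (cap p' (\<lambda>e. m (True # False # e)) d' + vv * cap p' (\<lambda>e. m (False # True # e)) d'))"
      by (simp add: cap_lin)
    then show ?thesis by (simp add: p d)
  qed
next
  case (Suc q)
  then obtain p' where p: "p = Suc p'" by (cases p) auto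
  with Suc show ?case by (cases d) simp_all
qed

lemma tlgen_far_commute:
  "p + 2 \<le> q \<Longrightarrow> tlgen p (tlgen q m) d = tlgen q (tlgen p m) d"
proof (induction p arbitrary: q m d)
  case 0
  then obtain q' where q: "q = Suc (Suc q')" by (metis add_0 add_2_eq_Suc le_Suc_ex)
  show ?case
  proof (cases "length d < 2")
    case True
    then show ?thesis using 0 by (simp add: tlgen_short)
  next
    case False
    then obtain x y d' where d: "d = x # y # d'" by (cases d rule: remdups_adj.cases) auto
    have "tlgen q' (\<lambda>e. (if x = y then 0 else (if x then inverse vv else 1) *
          (m (True # False # e) + vv * m (False # True # e)))) d' =
        (if x = y then 0 else (if x then inverse vv else 1) *
          (tlgen q' (\<lambda>e. m (True # False # e)) d' + vv * tlgen q' (\<lambda>e. m (False # True # e)) d'))"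
      by (simp add: tlgen_lin)
    then show ?thesis by (simp add: q d)
  qed
next
  case (Suc p)
  then obtain q' where q: "q = Suc q'" by (cases q) auto
  with Suc show ?case by (cases d) simp_all
qed

definition rmat :: "nat \<Rightarrow> nat \<Rightarrow> vec \<Rightarrow> vec" where
  "rmat p r m = (\<lambda>d. tlgen p m d - spec r * m d)"

lemma rmat_zero: "rmat p r (\<lambda>_. 0) = (\<lambda>_. 0)"
  by (simp add: rmat_def tlgen_lin)

lemma rmat_commute: "p + 2 \<le> q \<Longrightarrow> rmat p r (rmat q r' m) = rmat q r' (rmat p r m)"
  using tlgen_far_commute[of p q] by (intro ext) (simp add: rmat_def tlgen_lin algebra_simps)

lemma cap_rmat_same: "cap p (rmat p r m) = (\<lambda>d. (vv + inverse vv - spec r) * cap p m d)"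
  by (rule ext) (simp add: rmat_def cap_lin cap_tlgen_same left_diff_distrib)

lemma cap_rmat_above: "cap p (rmat (Suc p) r m) = (\<lambda>d. cap (Suc p) m d - spec r * cap p m d)"
  by (rule ext) (simp add: rmat_def cap_lin cap_tlgen_above)

lemma cap_rmat_below: "p < length d \<Longrightarrow> cap (Suc p) (rmat p r m) d = cap p m d - spec r * cap (Suc p) m d"
  by (simp add: rmat_def cap_lin cap_tlgen_below)

lemma cap_rmat_far_above: "p \<le> q \<Longrightarrow> cap p (rmat (Suc (Suc q)) r m) = rmat q r (cap p m)"
  using cap_tlgen_far_above[of p q] by (simp add: rmat_def cap_lin fun_eq_iff)

lemma cap_rmat_far_below: "q + 2 \<le> p \<Longrightarrow> cap p (rmat q r m) = rmat q r (cap p m)"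
  by (simp add: rmat_def cap_lin cap_tlgen_far_below fun_eq_iff)

text \<open>The terms with \<open>cap (Suc p) m\<close> have coefficient 1 - \<open>spec r\<close> *
  ([2] - \<open>spec (Suc r)\<close>), which vanishes just because the parameters are
  consecutive.\<close>

lemma cap_rmat_two_below:
  assumes "0 < r" "p < length d"
  shows "cap (Suc p) (rmat p r (rmat (Suc p) (Suc r) m)) d = - spec (Suc r) * cap p m d"
proof -
  have "cap (Suc p) (rmat p r (rmat (Suc p) (Suc r) m)) d =
     cap p m d - spec (Suc r) * cap p m d
       - spec r * (vv + inverse vv - spec (Suc r)) * cap (Suc p) m d - (1 - 1) * cap p m d
       + (cap (Suc p) m d - cap p m d)"
    using assms by (simp add: cap_rmat_below cap_rmat_above cap_rmat_same)
  then show ?thesis using spec_Suc[OF assms(1)] by simp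
qed

text \<open>
  The three boxes next to an outer corner, hit by the cap at that corner: up to a term with a
  neighbouring cap, the cap passes the box with the larger parameter, whose operator survives.
\<close>

lemma
  assumes "Suc p < length d" "0 < x" "0 < y"
  shows cap_rmat_corner_left:
      "cap (Suc p) (rmat p x (rmat (Suc (Suc p)) y (rmat (Suc p) (Suc x) m))) d =
       rmat p x (cap (Suc (Suc p)) (rmat (Suc p) (Suc x) m)) d + spec y * spec (Suc x) * cap p m d"
    and cap_rmat_corner_right:
      "cap (Suc p) (rmat p x (rmat (Suc (Suc p)) y (rmat (Suc p) (Suc y) m))) d =
       rmat p y (cap p (rmat (Suc p) (Suc y) m)) d + spec x * spec (Suc y) * cap (Suc (Suc p)) m d"
proof -
  define q where "q = (\<lambda>z. rmat (Suc p) z m)"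
  define w where "w = (\<lambda>z. rmat (Suc (Suc p)) y (q z))"
  \<comment> \<open>The cap is pushed through the two outer factors with the parameter z of the
    inner one left open; the two claims are z = x + 1 and z = y + 1.\<close>
  have capw: "cap (Suc p) (rmat p x (w z)) d = tlgen p (cap p (q z)) d - spec y * cap p (q z) d
      - spec x * (cap (Suc (Suc p)) (q z) d
          - spec y * ((vv + inverse vv - spec z) * cap (Suc p) m d))" for z
  proof -
    have "cap (Suc p) (rmat p x (w z)) d = cap p (w z) d - spec x * cap (Suc p) (w z) d"
      using assms by (simp add: cap_rmat_below)
    moreover have "cap p (w z) d = tlgen p (cap p (q z)) d - spec y * cap p (q z) d"
      by (simp add: w_def cap_rmat_far_above) (simp add: rmat_def)
    moreover have "cap (Suc p) (w z) d = cap (Suc (Suc p)) (q z) d - spec y * cap (Suc p) (q z) d"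
      by (simp add: w_def cap_rmat_above)
    moreover have "cap (Suc p) (q z) d = (vv + inverse vv - spec z) * cap (Suc p) m d"
      by (simp add: q_def cap_rmat_same)
    ultimately show ?thesis by simp
  qed
  have capq: "cap p (q z) d = cap (Suc p) m d - spec z * cap p m d"
    "cap (Suc (Suc p)) (q z) d = cap (Suc p) m d - spec z * cap (Suc (Suc p)) m d" for z
    using assms by (simp_all add: q_def cap_rmat_above cap_rmat_below)
  \<comment> \<open>Both sides are the cap at p + 1 after the commuting generators at p and p + 2:
    either generator can be absorbed into the cap, and the other passes the resulting cap.\<close>
  have join: "tlgen p (cap p (q z)) d = tlgen p (cap (Suc (Suc p)) (q z)) d" for z
  proof -
    have "tlgen p (cap p (q z)) d = cap p (tlgen (Suc (Suc p)) (q z)) d"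
      using cap_tlgen_far_above[of p p] by simp
    also have "\<dots> = cap (Suc p) (tlgen p (tlgen (Suc (Suc p)) (q z))) d"
      using assms by (simp add: cap_tlgen_below)
    also have "tlgen p (tlgen (Suc (Suc p)) (q z)) = tlgen (Suc (Suc p)) (tlgen p (q z))"
      using tlgen_far_commute[of p "Suc (Suc p)"] by (intro ext) simp
    also have "cap (Suc p) \<dots> d = tlgen p (cap (Suc (Suc p)) (q z)) d"
      by (simp add: cap_tlgen_above cap_tlgen_far_below)
    finally show ?thesis .
  qed
  \<comment> \<open>For z = x + 1 or z = y + 1 the recurrence makes the coefficient of
    \<open>cap (Suc p) m\<close> inside \<open>capw\<close> cancel; this is what singles out the two
    values of z.\<close>
  have sx: "spec x * ((vv + inverse vv - spec (Suc x)) * c) = c"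
    and sy: "spec y * ((vv + inverse vv - spec (Suc y)) * c) = c" for c
    using spec_Suc assms by (simp_all flip: mult.assoc)
  have "cap (Suc p) (rmat p x (w (Suc x))) d =
      rmat p x (cap (Suc (Suc p)) (q (Suc x))) d + spec y * spec (Suc x) * cap p m d"
    unfolding capw join capq(1) using sx[of "spec y * cap (Suc p) m d"]
    by (simp add: rmat_def algebra_simps)
  then show "cap (Suc p) (rmat p x (rmat (Suc (Suc p)) y (rmat (Suc p) (Suc x) m))) d =
       rmat p x (cap (Suc (Suc p)) (rmat (Suc p) (Suc x) m)) d + spec y * spec (Suc x) * cap p m d"
    by (simp add: w_def q_def)
  have "cap (Suc p) (rmat p x (w (Suc y))) d =
      rmat p y (cap p (q (Suc y))) d + spec x * spec (Suc y) * cap (Suc (Suc p)) m d"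
    unfolding capw sy capq(2)
    by (simp add: rmat_def algebra_simps)
  then show "cap (Suc p) (rmat p x (rmat (Suc (Suc p)) y (rmat (Suc p) (Suc y) m))) d =
       rmat p y (cap p (rmat (Suc p) (Suc y) m)) d + spec x * spec (Suc y) * cap (Suc (Suc p)) m d"
    by (simp add: w_def q_def)
qed

section \<open>Products over labelled boundary paths\<close>

text \<open>The number of pairs of a - before a +, which is the number of boxes of the diagram cut
  off by the path.\<close>

fun ninv :: "bool list \<Rightarrow> nat" where
  "ninv [] = 0"
| "ninv (b # xs) = (if b then 0 else count_list xs True) + ninv xs"

lemma ninv_swap: "ninv (A @ False # True # B) = Suc (ninv (A @ True # False # B))"
  by (induction A) auto

lemma split_first_ascent:
  "(\<exists>A x y B. s = A @ x # y # B \<and> \<not> P x \<and> P y) \<or>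
   (\<exists>A B. s = A @ B \<and> (\<forall>x\<in>set A. P x) \<and> (\<forall>x\<in>set B. \<not> P x))"
proof (induction s)
  case (Cons a s)
  consider (asc) A x y B where "s = A @ x # y # B" "\<not> P x" "P y"
    | (sorted) A B where "s = A @ B" "\<forall>x\<in>set A. P x" "\<forall>x\<in>set B. \<not> P x"
    using Cons by blast
  then show ?case
  proof cases
    case asc
    then have "a # s = (a # A) @ x # y # B" by simp
    with asc show ?thesis by blast
  next
    case sorted
    show ?thesis
    proof (cases "P a")
      case True
      then have "a # s = (a # A) @ B \<and> (\<forall>x\<in>set (a # A). P x) \<and> (\<forall>x\<in>set B. \<not> P x)" using sorted by simp
      then show ?thesis by blast
    next
      case False
      show ?thesis
      proof (cases A)
        case Nil
        then have "a # s = [] @ (a # B) \<and> (\<forall>x\<in>set []. P x) \<and> (\<forall>x\<in>set (a # B). \<not> P x)"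
          using sorted False by simp
        then show ?thesis by blast
      next
        case (Cons y A')
        then have "a # s = [] @ a # y # (A' @ B) \<and> \<not> P a \<and> P y" using sorted False by simp
        then show ?thesis by blast
      qed
    qed
  qed
qed simp

text \<open>
  A Young diagram is given by its boundary path, a step True (False) following the right edge of a
  row (the bottom edge of a column). Each step carries the parameter of the box outside the
  diagram across that edge, or 0; removing a corner box therefore determines its parameter.
\<close>

type_synonym lpath = "(bool \<times> nat) list"

text \<open>A relation, since a path may have several corners and no order of removing them is
  preferred. In the base case no box is left, and the labels do not enter.\<close>

inductive kl_prod_rel :: "lpath \<Rightarrow> vec \<Rightarrow> bool" where
  base: "(\<nexists>A p q B. s = A @ (False, p) # (True, q) # B) \<Longrightarrow> kl_prod_rel s (basisv (map fst s))"
| corner: "kl_prod_rel (A @ (True, Suc (max p q)) # (False, Suc (max p q)) # B) m \<Longrightarrow>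
    kl_prod_rel (A @ (False, p) # (True, q) # B) (rmat (length A) (Suc (max p q)) m)"

abbreviation lninv :: "lpath \<Rightarrow> nat" where
  "lninv s \<equiv> ninv (map fst s)"

lemma lninv_swap: "lninv (A @ (False, p) # (True, q) # B) = Suc (lninv (A @ (True, r) # (False, t) # B))"
  using ninv_swap[of "map fst A" "map fst B"] by simp

lemma kl_prod_rel_ex: "\<exists>m. kl_prod_rel s m"
proof (induction "lninv s" arbitrary: s rule: less_induct)
  case less
  show ?case
  proof (cases "\<exists>A p q B. s = A @ (False, p) # (True, q) # B")
    case True
    then obtain A p q B where s: "s = A @ (False, p) # (True, q) # B" by blast
    then have "\<exists>m. kl_prod_rel (A @ (True, Suc (max p q)) # (False, Suc (max p q)) # B) m"
      by (intro less) (simp add: ninv_swap)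
    with s show ?thesis by (blast intro: corner)
  qed (blast intro: base)
qed

text \<open>Two different places with a False step before a True step cannot overlap, as the shared
  step would be of both kinds.\<close>

lemma two_corners:
  assumes "A @ (False, p) # (True, q) # B = A' @ (False, p') # (True, q') # (B' :: lpath)"
  shows "(A = A' \<and> p = p' \<and> q = q' \<and> B = B') \<or>
    (\<exists>C. A' = A @ (False, p) # (True, q) # C \<and> B = C @ (False, p') # (True, q') # B') \<or>
    (\<exists>C. A = A' @ (False, p') # (True, q') # C \<and> B' = C @ (False, p) # (True, q) # B)"
  using assms
proof (induction A arbitrary: A')
  case Nil
  then show ?case
    by (cases A' rule: remdups_adj.cases) auto
next
  case (Cons a A)
  show ?case
  proof (cases A')
    case Nil
    then show ?thesis using Cons.prems by (cases A) auto
  next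
    case (Cons a' A'')
    then show ?thesis using Cons.IH[of A''] Cons.prems by auto
  qed
qed

text \<open>A diamond argument: two distinct corners are at least two positions apart, so their
  operators commute, and removing one leaves the labels at the other. Both removals lead to a common
  path, to which the induction hypothesis applies twice.\<close>

lemma kl_prod_rel_unique: "kl_prod_rel s m \<Longrightarrow> kl_prod_rel s m' \<Longrightarrow> m = m'"
proof (induction "lninv s" arbitrary: s m m' rule: less_induct)
  case less
  have apart: "rmat (length A) (Suc (max p q)) m1 = rmat (length A') (Suc (max p' q')) m2"
    if s: "s = A @ (False, p) # (True, q) # C @ (False, p') # (True, q') # B'"
      and A': "A' = A @ (False, p) # (True, q) # C"
      and m1: "kl_prod_rel (A @ (True, Suc (max p q)) # (False, Suc (max p q)) # C @ (False, p') # (True, q') # B') m1"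
      and m2: "kl_prod_rel (A' @ (True, Suc (max p' q')) # (False, Suc (max p' q')) # B') m2"
    for A A' B' C p q p' q' m1 m2
  proof -
    define z z' where "z = Suc (max p q)" and "z' = Suc (max p' q')"
    obtain m3 where m3: "kl_prod_rel (A @ (True, z) # (False, z) # C @ (True, z') # (False, z') # B') m3"
      using kl_prod_rel_ex by blast
    have "kl_prod_rel ((A @ (True, z) # (False, z) # C) @ (False, p') # (True, q') # B')
        (rmat (length (A @ (True, z) # (False, z) # C)) z' m3)"
      unfolding z'_def by (rule corner) (use m3 in \<open>simp add: z'_def\<close>)
    then have 1: "m1 = rmat (length A') z' m3"
      using m1 by (intro less(1)[of "A @ (True, z) # (False, z) # C @ (False, p') # (True, q') # B'"])
        (simp_all add: z_def s A' ninv_swap)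
    have "kl_prod_rel (A @ (False, p) # (True, q) # C @ (True, z') # (False, z') # B')
        (rmat (length A) z m3)"
      unfolding z_def by (rule corner) (use m3 in \<open>simp add: z_def\<close>)
    then have 2: "m2 = rmat (length A) z m3"
      using m2 lninv_swap[of "A @ (False, p) # (True, q) # C" p' q' B' z' z']
      by (intro less(1)[of "A @ (False, p) # (True, q) # C @ (True, z') # (False, z') # B'"])
        (simp_all add: z'_def s A')
    show ?thesis
      unfolding 1 2 z_def[symmetric] z'_def[symmetric] by (rule rmat_commute) (simp add: A')
  qed
  from less(2) show ?case
  proof cases
    case base
    from less(3) show ?thesis by cases (use base in auto)
  next
    case (corner A p q B m1)
    note c1 = corner
    from less(3) show ?thesis
    proof cases
      case base
      then show ?thesis using c1 by auto
    next
      case (corner A' p' q' B' m2)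
      from two_corners[of A p q B A' p' q' B'] c1(1) corner(1)
      consider "A = A'" "p = p'" "q = q'" "B = B'"
        | C where "A' = A @ (False, p) # (True, q) # C" "B = C @ (False, p') # (True, q') # B'"
        | C where "A = A' @ (False, p') # (True, q') # C" "B' = C @ (False, p) # (True, q) # B"
        by metis
      then show ?thesis
      proof cases
        case 1
        have "lninv (A @ (True, Suc (max p q)) # (False, Suc (max p q)) # B) < lninv s"
          unfolding c1(1) by (simp only: lninv_swap[of A p q B "Suc (max p q)" "Suc (max p q)"])
        from less(1)[OF this c1(3)] corner(3) 1 show ?thesis by (simp add: c1(2) corner(2))
      next
        case 2
        then show ?thesis using apart[of A p q C p' q' B' A' m1 m2] c1 corner by simp
      next
        case 3
        then show ?thesis using apart[of A' p' q' C p q B A m2 m1] c1 corner by simp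
      qed
    qed
  qed
qed

definition kl_prod :: "lpath \<Rightarrow> vec" where
  "kl_prod s = (THE m. kl_prod_rel s m)"

lemma kl_prod_eqI: "kl_prod_rel s m \<Longrightarrow> kl_prod s = m"
  unfolding kl_prod_def using kl_prod_rel_unique by blast

lemma kl_prod_rel: "kl_prod_rel s (kl_prod s)"
  using kl_prod_rel_ex kl_prod_eqI by metis

lemma kl_prod_corner:
  "kl_prod (A @ (False, p) # (True, q) # B) =
   rmat (length A) (Suc (max p q)) (kl_prod (A @ (True, Suc (max p q)) # (False, Suc (max p q)) # B))"
  by (intro kl_prod_eqI corner kl_prod_rel)

lemma kl_prod_base: "(\<nexists>A p q B. s = A @ (False, p) # (True, q) # B) \<Longrightarrow> kl_prod s = basisv (map fst s)"
  by (intro kl_prod_eqI base)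

lemma kl_prod_induct [case_names base corner]:
  assumes base: "\<And>s. (\<nexists>A p q B. s = A @ (False, p) # (True, q) # B) \<Longrightarrow> P s"
    and corner: "\<And>A p q z B. z = Suc (max p q) \<Longrightarrow> P (A @ (True, z) # (False, z) # B) \<Longrightarrow>
      P (A @ (False, p) # (True, q) # B)"
  shows "P s"
proof -
  obtain m where "kl_prod_rel s m" using kl_prod_rel_ex by blast
  then show ?thesis by induction (use base corner in blast)+
qed

lemma kl_prod_support: "length d \<noteq> length s \<Longrightarrow> kl_prod s d = 0"
proof (induction s arbitrary: d rule: kl_prod_induct)
  case (base s)
  then show ?case by (auto simp: kl_prod_base basisv_def)
next
  case (corner A p q z B)
  have "tlgen (length A) (kl_prod (A @ (True, z) # (False, z) # B)) d = 0"
  proof (cases "length d < length A + 2")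
    case False
    then obtain A' x y B' where d: "d = A' @ x # y # B'" "length A' = length A"
      by (metis add_2_eq_Suc' append_take_drop_id id_take_nth_drop le_add1 length_take linorder_not_less min.absorb2 order_trans Cons_nth_drop_Suc Suc_lessD add_Suc_right less_Suc_eq_le less_eq_Suc_le)
    show ?thesis unfolding d(1) d(2)[symmetric] tlgen_append using corner d by auto
  qed (simp add: tlgen_short)
  then show ?case using corner kl_prod_corner[of A p q B] by (simp add: rmat_def)
qed

text \<open>Some cap rules need a lower bound on the length of the sequence, so identities are
  checked at the one relevant length, and both sides are 0 elsewhere.\<close>

lemma cap_kl_prod_eqI:
  assumes "\<And>d. length d + 2 = length s \<Longrightarrow> cap p (kl_prod s) d = m d"
    and "\<And>d. length d + 2 \<noteq> length s \<Longrightarrow> m d = 0"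
  shows "cap p (kl_prod s) = m"
proof
  fix d
  show "cap p (kl_prod s) d = m d"
  proof (cases "length d + 2 = length s")
    case False
    have "cap p (kl_prod s) d = 0"
    proof (cases "p \<le> length d")
      case True
      then have "cap (length (take p d)) (kl_prod s) (take p d @ drop p d) = 0"
        unfolding cap_append using False by (simp add: kl_prod_support)
      then show ?thesis using True by simp
    qed (simp add: cap_short)
    then show ?thesis using assms(2) False by simp
  qed (simp add: assms(1))
qed

section \<open>Capping the products\<close>

definition cons_vec :: "bool \<Rightarrow> vec \<Rightarrow> vec" where
  "cons_vec b m d = (case d of [] \<Rightarrow> 0 | x # d' \<Rightarrow> if x = b then m d' else 0)"

lemma cons_vec_simps [simp]:
  "cons_vec b m [] = 0" "cons_vec b m (x # d) = (if x = b then m d else 0)"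
  by (simp_all add: cons_vec_def)

lemma rmat_cons_vec: "rmat (Suc p) r (cons_vec b m) = cons_vec b (rmat p r m)"
proof
  fix d show "rmat (Suc p) r (cons_vec b m) d = cons_vec b (rmat p r m) d"
    by (cases d) (auto simp: rmat_def tlgen_lin)
qed

lemma cap_cons_vec: "cap (Suc p) (cons_vec b m) = cons_vec b (cap p m)"
proof
  fix d show "cap (Suc p) (cons_vec b m) d = cons_vec b (cap p m) d"
    by (cases d) (auto simp: cap_lin)
qed

lemma cons_vec_zero: "cons_vec b (\<lambda>_. 0) = (\<lambda>_. 0)"
  by (rule ext) (simp add: cons_vec_def split: list.split)

lemma basisv_Cons: "basisv (b # xs) = cons_vec b (basisv xs)"
  by (rule ext) (auto simp: cons_vec_def basisv_def split: list.split)

text \<open>A leading True step has no False step before it and so never belongs to a corner: its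
  sign is a spectator.\<close>

lemma kl_prod_Cons_True: "kl_prod ((True, p) # s) = cons_vec True (kl_prod s)"
proof (induction s rule: kl_prod_induct)
  case (base s)
  have "(True, p) # s \<noteq> A @ (False, p') # (True, q') # B" for A p' q' B
    using base by (cases A) auto
  then show ?case using base by (simp add: kl_prod_base basisv_Cons)
next
  case (corner A a b z B)
  then show ?case
    using kl_prod_corner[of "(True, p) # A" a b B] kl_prod_corner[of A a b B]
    by (simp add: rmat_cons_vec)
qed

section \<open>Transposition of diagrams: the path is reversed and its two kinds of edges are
  exchanged\<close>

definition flip :: "lpath \<Rightarrow> lpath" where
  "flip s = rev (map (\<lambda>(b, p). (\<not> b, p)) s)"

lemma flip_simps [simp]:
  "flip (A @ B) = flip B @ flip A" "flip ((b, p) # s) = flip s @ [(\<not> b, p)]" "flip [] = []"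
  "length (flip s) = length s" "flip (flip s) = s"
  by (simp_all add: flip_def rev_map comp_def case_prod_unfold)

abbreviation bflip :: "bool list \<Rightarrow> bool list" where
  "bflip d \<equiv> rev (map Not d)"

lemma bflip_bflip: "bflip (bflip d) = d"
  by (simp add: rev_map comp_def)

lemma split_two: "length d = n + k + 2 \<Longrightarrow> \<exists>A x y B. d = A @ x # y # B \<and> length A = n \<and> length B = k"
proof (induction n arbitrary: d)
  case 0
  then show ?case by (cases d rule: remdups_adj.cases) auto
next
  case (Suc n)
  then obtain a d' where d: "d = a # d'" by (cases d) auto
  with Suc.IH[of d'] Suc.prems obtain A x y B where
    "d' = A @ x # y # B" "length A = n" "length B = k" by auto
  then have "d = (a # A) @ x # y # B \<and> length (a # A) = Suc n \<and> length B = k" by (simp add: d)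
  then show ?case by blast
qed

text \<open>Reversing and negating maps + - to itself and - + to itself, so the weights of cap and
  cup are unchanged.\<close>

lemma tlgen_bflip:
  assumes "length d = a + b + 2"
  shows "tlgen a (\<lambda>e. m (bflip e)) d = tlgen b m (bflip d)"
proof -
  from split_two[OF assms] obtain A x y B where d: "d = A @ x # y # B" "length A = a" "length B = b" by blast
  have "tlgen (length A) (\<lambda>e. m (bflip e)) (A @ x # y # B) = tlgen (length (bflip B)) m (bflip B @ (\<not> y) # (\<not> x) # bflip A)"
    unfolding tlgen_append by simp
  then show ?thesis by (simp add: d)
qed

lemma kl_prod_flip: "kl_prod (flip s) d = kl_prod s (bflip d)"
proof (induction s arbitrary: d rule: kl_prod_induct)
  case (base s)
  have "flip s \<noteq> A @ (False, p) # (True, q) # B" for A p q B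
  proof
    assume "flip s = A @ (False, p) # (True, q) # B"
    then have "flip (flip s) = flip B @ (False, q) # (True, p) # flip A" by simp
    then show False using base by auto
  qed
  moreover have "map fst (flip s) = bflip (map fst s)"
    by (simp add: flip_def rev_map comp_def case_prod_unfold)
  moreover have "d = bflip (map fst s) \<longleftrightarrow> bflip d = map fst s"
    using bflip_bflip[of d] bflip_bflip[of "map fst s"] by metis
  ultimately show ?case using base by (simp add: kl_prod_base basisv_def)
next
  case (corner A p q z B)
  show ?case
  proof (cases "length d = length B + length A + 2")
    case False
    then show ?thesis by (simp add: kl_prod_support)
  next
    case True
    have IH: "kl_prod (flip (A @ (True, z) # (False, z) # B)) = (\<lambda>e. kl_prod (A @ (True, z) # (False, z) # B) (bflip e))"
      using corner by blast
    have "kl_prod (flip (A @ (False, p) # (True, q) # B)) d =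
        rmat (length B) z (kl_prod (flip (A @ (True, z) # (False, z) # B))) d"
      using kl_prod_corner[of "flip B" q p "flip A"] corner by (simp add: max.commute)
    then show ?thesis
      using kl_prod_corner[of A p q B] corner tlgen_bflip[OF True]
      unfolding IH by (simp add: rmat_def)
  qed
qed

lemma cap_kl_prod_flip:
  assumes "length d = a + b"
  shows "cap a (kl_prod (flip s)) d = cap b (kl_prod s) (bflip d)"
proof -
  define A B where "A = take a d" and "B = drop a d"
  have "cap (length A) (kl_prod (flip s)) (A @ B) = cap (length (bflip B)) (kl_prod s) (bflip B @ bflip A)"
    unfolding cap_append kl_prod_flip by simp
  moreover have "length A = a" "length (bflip B) = b" "A @ B = d" "bflip B @ bflip A = bflip d"
    using assms by (simp_all add: A_def B_def flip: rev_append map_append)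
  ultimately show ?thesis by simp
qed

lemma cap_kl_prod_all_True:
  "\<forall>x\<in>set A. fst x \<Longrightarrow> cap (length A) (kl_prod (A @ (True, p) # (True, q) # B)) = (\<lambda>_. 0)"
proof (induction A)
  case Nil
  then show ?case by (intro ext) (simp add: kl_prod_Cons_True)
next
  case (Cons a A)
  then obtain r where "a = (True, r)" by (cases a) auto
  with Cons show ?case by (simp add: kl_prod_Cons_True cap_cons_vec cons_vec_zero)
qed

text \<open>Corners inside A commute with the cap, so the real case is a False step just before the
  pair. It gives two boxes with consecutive parameters, which \<open>cap_rmat_two_below\<close>
  reduces to a cap at the pair moved one place to the left. The inequality on labels forces the
  parameters to be consecutive and holds again, as an equality, for the moved pair.\<close>

lemma cap_kl_prod_True_True:
  "q \<le> Suc p \<Longrightarrow> cap (length A) (kl_prod (A @ (True, p) # (True, q) # B)) = (\<lambda>_. 0)"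
proof (induction "lninv (A @ (True, p) # (True, q) # B)" arbitrary: A p q B rule: less_induct)
  case less
  consider (asc) A1 a b A2 where "A = A1 @ (False, a) # (True, b) # A2"
    | (all) "\<forall>x\<in>set A. fst x" | (last) A' x0 where "A = A' @ [(False, x0)]"
  proof -
    from split_first_ascent[of A fst] consider
      A1 x y A2 where "A = A1 @ x # y # A2" "\<not> fst x" "fst y"
      | P N where "A = P @ N" "\<forall>x\<in>set P. fst x" "\<forall>x\<in>set N. \<not> fst x" by blast
    then show thesis
    proof cases
      case 1
      then show thesis using asc by (metis (full_types) prod.collapse)
    next
      case 2
      then show thesis
      proof (cases N rule: rev_cases)
        case (snoc N' y)
        then show thesis using 2 last[of "P @ N'" "snd y"] by (cases y) auto
      qed (use 2 all in simp)
    qed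
  qed
  then show ?case
  proof cases
    case asc
    define z where "z = Suc (max a b)"
    define A' where "A' = A1 @ (True, z) # (False, z) # A2"
    have "kl_prod (A @ (True, p) # (True, q) # B) = rmat (length A1) z (kl_prod (A' @ (True, p) # (True, q) # B))"
      using kl_prod_corner[of A1 a b] by (simp add: asc A'_def z_def)
    moreover have "length A = length A'" by (simp add: asc A'_def)
    moreover have "length A1 + 2 \<le> length A'" by (simp add: A'_def)
    moreover have "cap (length A') (kl_prod (A' @ (True, p) # (True, q) # B)) = (\<lambda>_. 0)"
      using less(2) by (intro less(1)) (simp_all add: asc A'_def ninv_swap)
    ultimately show ?thesis by (simp add: cap_rmat_far_below rmat_zero)
  next
    case all
    then show ?thesis by (rule cap_kl_prod_all_True)
  next
    case last
    define x where "x = Suc (max x0 p)"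
    define m where "m = kl_prod (A' @ (True, x) # (True, Suc x) # (False, Suc x) # B)"
    \<comment> \<open>The second box has label x below and q to the right; since q is at most p + 1,
      hence at most x, its parameter is x + 1.\<close>
    have "max x q = x" using less(2) by (simp add: x_def)
    then have kl: "kl_prod (A @ (True, p) # (True, q) # B) = rmat (length A') x (rmat (Suc (length A')) (Suc x) m)"
      using kl_prod_corner[of A' x0 p "(True, q) # B"] kl_prod_corner[of "A' @ [(True, x)]" x q B]
      by (simp add: last x_def m_def)
    have capm: "cap (length A') m = (\<lambda>_. 0)"
      unfolding m_def
      using ninv_swap[of "map fst A'" "True # map fst B"] ninv_swap[of "map fst A' @ [True]" "map fst B"]
      by (intro less(1)) (simp_all add: last)
    show ?thesis
    proof (rule cap_kl_prod_eqI)
      fix d :: "bool list"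
      assume "length d + 2 = length (A @ (True, p) # (True, q) # B)"
      then have "length A' < length d" by (simp add: last)
      then show "cap (length A) (kl_prod (A @ (True, p) # (True, q) # B)) d = 0"
        unfolding kl using cap_rmat_two_below[of x "length A'" d m] capm
        by (simp add: last x_def)
    qed simp
  qed
qed

lemma cap_kl_prod_False_False:
  assumes "p \<le> Suc q"
  shows "cap (length A) (kl_prod (A @ (False, p) # (False, q) # B)) = (\<lambda>_. 0)"
proof (rule cap_kl_prod_eqI)
  fix d :: "bool list"
  assume d: "length d + 2 = length (A @ (False, p) # (False, q) # B)"
  have "cap (length A) (kl_prod (flip (flip B @ (True, q) # (True, p) # flip A))) d =
      cap (length (flip B)) (kl_prod (flip B @ (True, q) # (True, p) # flip A)) (bflip d)"
    using d by (intro cap_kl_prod_flip) simp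
  then show "cap (length A) (kl_prod (A @ (False, p) # (False, q) # B)) d = 0"
    using cap_kl_prod_True_True[OF assms, of "flip B" "flip A"] by simp
qed simp

text \<open>No condition on labels is needed at the left end. A corner that touches the peak
  contributes its parameter only with the cap at 0, which kills sequences starting + +.\<close>

lemma cap_kl_prod_peak_Nil: "cap 0 (kl_prod ((True, p) # (False, q) # B)) = kl_prod B"
proof (induction "lninv ((False, q) # B)" arbitrary: p q B rule: less_induct)
  case less
  consider (start) y B' where "B = (True, y) # B'"
    | (asc) B1 a b B2 where "B = B1 @ (False, a) # (True, b) # B2"
    | (all) "\<forall>x\<in>set B. \<not> fst x"
  proof -
    from split_first_ascent[of B fst] consider
      B1 x y B2 where "B = B1 @ x # y # B2" "\<not> fst x" "fst y"
      | P N where "B = P @ N" "\<forall>x\<in>set P. fst x" "\<forall>x\<in>set N. \<not> fst x" by blast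
    then show thesis
    proof cases
      case 1
      then show thesis using asc by (metis (full_types) prod.collapse)
    next
      case 2
      then show thesis
      proof (cases P)
        case (Cons y P')
        then show thesis using 2 start[of "snd y" "P' @ N"] by (cases y) auto
      qed (use 2 all in simp)
    qed
  qed
  then show ?case
  proof cases
    case start
    define z where "z = Suc (max q y)"
    have "kl_prod ((True, p) # (False, q) # B) = rmat (Suc 0) z (cons_vec True (kl_prod ((True, z) # (False, z) # B')))"
      using kl_prod_corner[of "[(True, p)]" q y B'] by (simp add: start z_def kl_prod_Cons_True)
    moreover have "cap 0 (kl_prod ((True, z) # (False, z) # B')) = kl_prod B'"
      by (rule less) (simp add: start)
    moreover have "cap 0 (cons_vec True (cons_vec True m)) = (\<lambda>_. 0)" for m
      by (intro ext) simp
    ultimately show ?thesis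
      by (intro ext) (simp add: start cap_rmat_above cap_cons_vec kl_prod_Cons_True)
  next
    case asc
    define z where "z = Suc (max a b)"
    define B' where "B' = B1 @ (True, z) # (False, z) # B2"
    have "kl_prod ((True, p) # (False, q) # B) = rmat (Suc (Suc (length B1))) z (kl_prod ((True, p) # (False, q) # B'))"
      using kl_prod_corner[of "(True, p) # (False, q) # B1" a b B2] by (simp add: asc z_def B'_def)
    moreover have "cap 0 (kl_prod ((True, p) # (False, q) # B')) = kl_prod B'"
      by (rule less) (simp add: asc B'_def ninv_swap)
    moreover have "kl_prod B = rmat (length B1) z (kl_prod B')"
      using kl_prod_corner[of B1 a b B2] by (simp add: asc z_def B'_def)
    ultimately show ?thesis by (simp add: cap_rmat_far_above)
  next
    case all
    have 1: "B \<noteq> A @ (False, a) # (True, b) # C" for A a b C using all by auto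
    then have "(True, p) # (False, q) # B \<noteq> A @ (False, a) # (True, b) # C" for A a b C
      using all by (cases A rule: remdups_adj.cases) auto
    with 1 show ?thesis by (intro ext) (auto simp: kl_prod_base basisv_def)
  qed
qed

lemma cap_kl_prod_peak_all_True:
  "\<forall>x\<in>set A. fst x \<Longrightarrow> cap (length A) (kl_prod (A @ (True, p) # (False, q) # B)) = kl_prod (A @ B)"
proof (induction A)
  case Nil
  then show ?case by (simp add: cap_kl_prod_peak_Nil)
next
  case (Cons a A)
  then obtain r where "a = (True, r)" by (cases a) auto
  with Cons show ?case by (simp add: kl_prod_Cons_True cap_cons_vec)
qed

lemma cap_kl_prod_peak_all_False:
  assumes "\<forall>x\<in>set B. \<not> fst x"
  shows "cap (length A) (kl_prod (A @ (True, p) # (False, q) # B)) = kl_prod (A @ B)"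
proof (rule cap_kl_prod_eqI)
  fix d :: "bool list"
  assume d: "length d + 2 = length (A @ (True, p) # (False, q) # B)"
  have "cap (length A) (kl_prod (flip (flip B @ (True, q) # (False, p) # flip A))) d =
      cap (length (flip B)) (kl_prod (flip B @ (True, q) # (False, p) # flip A)) (bflip d)"
    using d by (intro cap_kl_prod_flip) simp
  also have "cap (length (flip B)) (kl_prod (flip B @ (True, q) # (False, p) # flip A)) = kl_prod (flip (A @ B))"
    using cap_kl_prod_peak_all_True[of "flip B" q p "flip A"] assms
    by (force simp: flip_def)
  also have "kl_prod (flip (A @ B)) (bflip d) = kl_prod (A @ B) d"
    by (simp add: kl_prod_flip bflip_bflip del: flip_simps(1))
  finally show "cap (length A) (kl_prod (A @ (True, p) # (False, q) # B)) d = kl_prod (A @ B) d"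
    by simp
qed (simp add: kl_prod_support)

text \<open>The condition under which deleting the row and the column at the peak does not change the
  parameters of the boxes that remain.\<close>

definition peak_labels_small :: "lpath \<Rightarrow> nat \<Rightarrow> nat \<Rightarrow> lpath \<Rightarrow> bool" where
  "peak_labels_small A p q B \<longleftrightarrow> p = 0 \<and> q = 0 \<or>
     (\<exists>A' x. A = A' @ [(False, x)] \<and> p \<le> x \<and> q \<le> x) \<or>
     (\<exists>y B'. B = (True, y) # B' \<and> p \<le> y \<and> q \<le> y)"

text \<open>Corners away from the peak commute with the cap, and monotone sides are the previous
  lemmas. What remains is False before and True after the peak, where three boxes meet. The corner
  identities then leave a cap at a shifted peak, handled by induction, and a cap on two equal steps,
  which is 0.\<close>

lemma cap_kl_prod_peak:
  "peak_labels_small A p q B \<Longrightarrow>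
   cap (length A) (kl_prod (A @ (True, p) # (False, q) # B)) = kl_prod (A @ B)"
proof (induction "lninv (A @ (True, p) # (False, q) # B)" arbitrary: A p q B rule: less_induct)
  case less
  note split_A = split_first_ascent[of A fst] and split_B = split_first_ascent[of B fst]
  consider (ascA) A1 a b A2 where "A = A1 @ (False, a) # (True, b) # A2"
    | (ascB) B1 a b B2 where "B = B1 @ (False, a) # (True, b) # B2"
    | (allA) "\<forall>x\<in>set A. fst x" | (allB) "\<forall>x\<in>set B. \<not> fst x"
    | (mid) A' x0 y0 B' where "A = A' @ [(False, x0)]" "B = (True, y0) # B'"
  proof (cases "(\<exists>A1 x y A2. A = A1 @ x # y # A2 \<and> \<not> fst x \<and> fst y) \<or> (\<exists>A1 x y A2. B = A1 @ x # y # A2 \<and> \<not> fst x \<and> fst y)")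
    case True
    then show thesis using ascA ascB by (metis (full_types) prod.collapse)
  next
    case False
    then obtain PA NA PB NB where
      A: "A = PA @ NA" "\<forall>x\<in>set PA. fst x" "\<forall>x\<in>set NA. \<not> fst x" and
      B: "B = PB @ NB" "\<forall>x\<in>set PB. fst x" "\<forall>x\<in>set NB. \<not> fst x"
      using split_A split_B by blast
    show thesis
    proof (cases NA rule: rev_cases)
      case Nil
      then show thesis using A allA by simp
    next
      case (snoc N' x)
      show thesis
      proof (cases PB)
        case Nil
        then show thesis using B allB by simp
      next
        case (Cons y P')
        then show thesis
          using A B snoc mid[of "PA @ N'" "snd x" "snd y" "P' @ NB"] by (cases x; cases y) auto
      qed
    qed
  qed
  then show ?case
  proof cases
    case ascA
    define z where "z = Suc (max a b)"
    define A' where "A' = A1 @ (True, z) # (False, z) # A2"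
    have kl: "kl_prod (A @ C) = rmat (length A1) z (kl_prod (A' @ C))" for C
      using kl_prod_corner[of A1 a b] by (simp add: ascA A'_def z_def)
    have len: "length A = length A'" "length A1 + 2 \<le> length A'" by (simp_all add: ascA A'_def)
    \<comment> \<open>The removed corner ends in a True step, so a final False step of A lies behind
      it and keeps its label.\<close>
    have "peak_labels_small A' p q B"
      using less(2) unfolding peak_labels_small_def
    proof (elim disjE exE conjE)
      fix C x assume C: "A = C @ [(False, x)]" "p \<le> x" "q \<le> x"
      then obtain A3 where "A2 = A3 @ [(False, x)]"
        using ascA by (cases A2 rule: rev_cases) auto
      then have "A' = (A1 @ (True, z) # (False, z) # A3) @ [(False, x)]" by (simp add: A'_def)
      with C show "p = 0 \<and> q = 0 \<or> (\<exists>C x. A' = C @ [(False, x)] \<and> p \<le> x \<and> q \<le> x) \<or>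
        (\<exists>y B'. B = (True, y) # B' \<and> p \<le> y \<and> q \<le> y)" by blast
    qed blast+
    then have "cap (length A') (kl_prod (A' @ (True, p) # (False, q) # B)) = kl_prod (A' @ B)"
      by (intro less(1)) (simp_all add: ascA A'_def ninv_swap)
    with len show ?thesis by (simp add: kl cap_rmat_far_below)
  next
    case ascB
    define z where "z = Suc (max a b)"
    define B' where "B' = B1 @ (True, z) # (False, z) # B2"
    have kl: "kl_prod (C @ B) = rmat (length C + length B1) z (kl_prod (C @ B'))" for C
      using kl_prod_corner[of "C @ B1" a b] by (simp add: ascB B'_def z_def)
    have "peak_labels_small A p q B'"
      using less(2) unfolding peak_labels_small_def
    proof (elim disjE exE conjE)
      fix C x assume C: "B = (True, x) # C" "p \<le> x" "q \<le> x"
      then obtain B3 where "B1 = (True, x) # B3"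
        using ascB by (cases B1) auto
      then have "B' = (True, x) # (B3 @ (True, z) # (False, z) # B2)" by (simp add: B'_def)
      with C show "p = 0 \<and> q = 0 \<or> (\<exists>C x. A = C @ [(False, x)] \<and> p \<le> x \<and> q \<le> x) \<or>
        (\<exists>y C. B' = (True, y) # C \<and> p \<le> y \<and> q \<le> y)" by blast
    qed blast+
    then have "cap (length A) (kl_prod (A @ (True, p) # (False, q) # B')) = kl_prod (A @ B')"
      using ninv_swap[of "map fst A @ True # False # map fst B1" "map fst B2"]
      by (intro less(1)) (simp_all add: ascB B'_def)
    then show ?thesis
      using kl[of "A @ [(True, p), (False, q)]"] by (simp add: kl cap_rmat_far_above)
  next
    case allA
    then show ?thesis by (rule cap_kl_prod_peak_all_True)
  next
    case allB
    then show ?thesis by (rule cap_kl_prod_peak_all_False)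
  next
    case mid
    define x y where "x = Suc (max x0 p)" and "y = Suc (max q y0)"
    define z where "z = Suc (max x y)"
    define m where "m = kl_prod (A' @ (True, x) # (True, z) # (False, z) # (False, y) # B')"
    have kl1: "rmat (Suc (length A')) z m = kl_prod (A' @ (True, x) # (False, x) # (True, y) # (False, y) # B')"
      using kl_prod_corner[of "A' @ [(True, x)]" x y "(False, y) # B'"] by (simp add: m_def z_def)
    have kl: "kl_prod (A @ (True, p) # (False, q) # B) =
        rmat (length A') x (rmat (Suc (Suc (length A'))) y (rmat (Suc (length A')) z m))"
      using kl_prod_corner[of A' x0 p "(False, q) # (True, y0) # B'"]
        kl_prod_corner[of "A' @ [(True, x), (False, x)]" q y0 B']
      by (simp add: mid x_def y_def kl1)
    have AB: "kl_prod (A @ B) = rmat (length A') (Suc (max x0 y0)) (kl_prod (A' @ (True, Suc (max x0 y0)) # (False, Suc (max x0 y0)) # B'))"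
      using kl_prod_corner[of A' x0 y0 B'] by (simp add: mid)
    \<comment> \<open>Therefore the larger of x and y is 1 + max x0 y0, the parameter that the
      merged corner has once the peak is deleted.\<close>
    have small: "p \<le> max x0 y0" "q \<le> max x0 y0"
      using less(2) by (auto simp: peak_labels_small_def mid)
    have inv: "lninv (A @ (True, p) # (False, q) # B) =
        Suc (Suc (ninv (map fst A' @ True # False # True # False # map fst B')))"
      using ninv_swap[of "map fst A'" "False # True # map fst B'"]
        ninv_swap[of "map fst A' @ [True, False]" "map fst B'"] by (simp add: mid)
    show ?thesis
    proof (cases "x \<ge> y")
      case True
      then have z: "z = Suc x" and x: "Suc (max x0 y0) = x"
        using small by (auto simp: z_def x_def y_def)
      \<comment> \<open>The labels x and x + 1 of the two True steps meet the bound of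
        \<open>cap_kl_prod_True_True\<close> with equality.\<close>
      have "cap (length A') m = (\<lambda>_. 0)"
        unfolding m_def z by (rule cap_kl_prod_True_True) simp
      moreover have "cap (Suc (Suc (length A'))) (rmat (Suc (length A')) z m) = kl_prod (A' @ (True, x) # (False, x) # B')"
        using less(1)[of "A' @ [(True, x), (False, x)]" y y B'] True inv
        by (simp add: kl1 peak_labels_small_def)
      ultimately show ?thesis
      proof (intro cap_kl_prod_eqI)
        fix d :: "bool list"
        assume "length d + 2 = length (A @ (True, p) # (False, q) # B)"
        then have d: "Suc (length A') < length d" by (simp add: mid)
        assume "cap (length A') m = (\<lambda>_. 0)"
          "cap (Suc (Suc (length A'))) (rmat (Suc (length A')) z m) = kl_prod (A' @ (True, x) # (False, x) # B')"
        then show "cap (length A) (kl_prod (A @ (True, p) # (False, q) # B)) d = kl_prod (A @ B) d"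
          using cap_rmat_corner_left[OF d, of x y m] unfolding kl AB x z
          by (simp add: mid x_def y_def)
      qed (simp add: kl_prod_support)
    next
      case False
      then have z: "z = Suc y" and y: "Suc (max x0 y0) = y"
        using small by (auto simp: z_def x_def y_def)
      have "cap (Suc (Suc (length A'))) m = (\<lambda>_. 0)"
        using cap_kl_prod_False_False[of z y "A' @ [(True, x), (True, z)]" B'] by (simp add: m_def z)
      moreover have "cap (length A') (rmat (Suc (length A')) z m) = kl_prod (A' @ (True, y) # (False, y) # B')"
        using less(1)[of A' x x "(True, y) # (False, y) # B'"] False inv
        by (simp add: kl1 peak_labels_small_def)
      ultimately show ?thesis
      proof (intro cap_kl_prod_eqI)
        fix d :: "bool list"
        assume "length d + 2 = length (A @ (True, p) # (False, q) # B)"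
        then have d: "Suc (length A') < length d" by (simp add: mid)
        assume "cap (Suc (Suc (length A'))) m = (\<lambda>_. 0)"
          "cap (length A') (rmat (Suc (length A')) z m) = kl_prod (A' @ (True, y) # (False, y) # B')"
        then show "cap (length A) (kl_prod (A @ (True, p) # (False, q) # B)) d = kl_prod (A @ B) d"
          using cap_rmat_corner_right[OF d, of x y m] unfolding kl AB y z
          by (simp add: mid x_def y_def)
      qed (simp add: kl_prod_support)
    qed
  qed
qed

section \<open>Coefficients\<close>

lemma tlgen_swap:
  "tlgen (length A) m (A @ x # y # B) =
   (if x = y then 0 else m (A @ y # x # B) + (if x then inverse vv else vv) * m (A @ x # y # B))"
  unfolding tlgen_append by (auto simp: distrib_left)

lemma ninv_le: "ninv xs \<le> count_list xs False * count_list xs True"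
  by (induction xs) auto

lemma ninv_sorted: "ninv (replicate a False @ replicate b True) = a * b"
proof -
  have "ninv (replicate b True) = 0" by (induction b) simp_all
  moreover have "count_list (replicate a False @ replicate b True) True = b" for a by (induction a, induction b) simp_all
  ultimately show ?thesis by (induction a) simp_all
qed

lemma count_list_bool: "count_list xs False + count_list xs True = length xs"
  by (induction xs) auto

lemma ninv_swap_le: "ninv (A @ x # y # B) \<le> Suc (ninv (A @ y # x # B))"
  using ninv_swap[of A B] by (cases x; cases y) auto

text \<open>Every operator raises the number of inversions by at most one.\<close>

lemma kl_prod_top: "lninv s \<le> ninv d \<Longrightarrow> kl_prod s d = basisv (map fst s) d"
proof (induction s arbitrary: d rule: kl_prod_induct)
  case (base s)
  then show ?case by (simp add: kl_prod_base)
next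
  case (corner A p q z B)
  define s' where "s' = A @ (True, z) # (False, z) # B"
  have inv: "lninv (A @ (False, p) # (True, q) # B) = Suc (lninv s')"
    by (simp add: s'_def ninv_swap)
  then have le: "Suc (lninv s') \<le> ninv d" using corner by simp
  show ?case
  proof (cases "length d = length s'")
    case False
    then show ?thesis by (simp add: kl_prod_support s'_def) (auto simp: basisv_def)
  next
    case True
    then have "length d = length A + length B + 2" by (simp add: s'_def)
    from split_two[OF this] obtain C x y D where
      d: "d = C @ x # y # D" and len: "length C = length A" "length D = length B" by blast
    have "kl_prod s' d = basisv (map fst s') d" "map fst s' \<noteq> d"
      using corner(2)[of d] le by (auto simp: s'_def)
    then have 0: "kl_prod s' d = 0" by (simp add: basisv_def)
    have "lninv s' \<le> ninv (C @ y # x # D)" using ninv_swap_le[of C x y D] le d by simp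
    then have 1: "kl_prod s' (C @ y # x # D) = basisv (map fst s') (C @ y # x # D)"
      unfolding s'_def by (rule corner(2))
    have "kl_prod (A @ (False, p) # (True, q) # B) d = tlgen (length C) (kl_prod s') d"
      using kl_prod_corner[of A p q B] corner(1) 0 by (simp add: rmat_def s'_def len)
    also have "\<dots> = (if x = y then 0 else basisv (map fst s') (C @ y # x # D))"
      using 0 1 by (cases x; cases y) (simp_all add: d tlgen_swap)
    also have "\<dots> = basisv (map fst (A @ (False, p) # (True, q) # B)) d"
      using len by (auto simp: basisv_def s'_def d)
    finally show ?thesis .
  qed
qed

text \<open>Label 0 means that no box lies beyond the edge, so the parameters are the r_ij of the
  diagram itself.\<close>

abbreviation zero_labels :: "bool list \<Rightarrow> lpath" where
  "zero_labels e \<equiv> map (\<lambda>b. (b, 0)) e"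

text \<open>The case - + is a corner whose last box has parameter 1, and \<open>spec 1\<close> = [2]
  makes the cap annihilate its factor.\<close>

lemma cap_kl_prod_zero_labels:
  assumes "length A = p"
  shows "cap p (kl_prod (zero_labels (A @ x # y # B))) =
    (if x \<and> \<not> y then kl_prod (zero_labels (A @ B)) else (\<lambda>_. 0))"
proof -
  have "length (zero_labels A) = p" using assms by simp
  then show ?thesis
    using cap_kl_prod_peak[of "zero_labels A" 0 0 "zero_labels B"]
      cap_kl_prod_True_True[of 0 0 "zero_labels A" "zero_labels B"]
      cap_kl_prod_False_False[of 0 0 "zero_labels A" "zero_labels B"]
      kl_prod_corner[of "zero_labels A" 0 0 "zero_labels B"]
    by (cases x; cases y) (auto simp: peak_labels_small_def cap_rmat_same spec_1)
qed

lemma bool_list_cases: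
  obtains (peak) A B where "d = A @ True # False # B"
  | (top) a b where "d = replicate a False @ replicate b True"
  using split_first_ascent[of d Not]
proof
  assume "\<exists>A x y B. d = A @ x # y # B \<and> \<not> \<not> x \<and> \<not> y"
  then obtain A x y B where "d = A @ x # y # B" "x" "\<not> y" by blast
  then show thesis using peak[of A B] by simp
next
  assume "\<exists>A B. d = A @ B \<and> (\<forall>x\<in>set A. \<not> x) \<and> (\<forall>x\<in>set B. \<not> \<not> x)"
  then obtain A B where "d = A @ B" "\<forall>x\<in>set A. \<not> x" "\<forall>x\<in>set B. \<not> \<not> x" by (elim exE conjE)
  moreover from this have "A = replicate (length A) False" "B = replicate (length B) True"
    using replicate_length_same[of A False] replicate_length_same[of B True] by simp_all
  ultimately show thesis using top by metis
qed

text \<open>The outer induction on length serves the smaller diagram left by the cap. The inner one,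
  on the inversions that d still lacks, serves the coefficient with + - turned into - +; it ends at
  the sequence with all - first, where \<open>kl_prod_top\<close> applies.\<close>

lemma kl_prod_lattice:
  assumes "length d = length e" "count_list d True = count_list e True"
  shows "in_vZv (kl_prod (zero_labels e) d - basisv e d)"
  using assms
proof (induction "length e" arbitrary: d e rule: less_induct)
  case less
  note shorter = less(1)
  show ?case using less(2,3)
  proof (induction "count_list d False * count_list d True - ninv d" arbitrary: d rule: less_induct)
    case less
    show ?case
    proof (cases d rule: bool_list_cases)
      case (top a b)
      note d = top
      have "count_list d False = count_list e False"
        using less(2,3) count_list_bool[of d] count_list_bool[of e] by simp
      moreover have "count_list d False * count_list d True = a * b"
      proof -
        have "count_list (replicate a False) False = a" "count_list (replicate a False) True = 0"
          "count_list (replicate b True) False = 0" "count_list (replicate b True) True = b"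
          by (induction a, simp_all) (induction b, simp_all)+
        then show ?thesis by (simp add: d)
      qed
      ultimately have "ninv e \<le> ninv d"
        using less(3) ninv_le[of e] by (simp add: d ninv_sorted)
      then have "kl_prod (zero_labels e) d = basisv e d"
        using kl_prod_top[of "zero_labels e" d] by (simp add: comp_def)
      then show ?thesis by (simp add: in_vZv_0)
    next
      case (peak A B)
      note d = peak
      define d' where "d' = A @ False # True # B"
      have "length e = length A + length B + 2" using less(2) d by simp
      from split_two[OF this] obtain A2 x y B2 where
        e: "e = A2 @ x # y # B2" and len: "length A2 = length A" "length B2 = length B" by blast
      have "cap (length A) (kl_prod (zero_labels e)) (A @ B) =
          (if x \<and> \<not> y then kl_prod (zero_labels (A2 @ B2)) (A @ B) else 0)"
        unfolding e cap_kl_prod_zero_labels[OF len(1)] by simp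
      then have eq: "kl_prod (zero_labels e) d = (if x \<and> \<not> y then kl_prod (zero_labels (A2 @ B2)) (A @ B) else 0)
           - vv * kl_prod (zero_labels e) d'"
        unfolding cap_append d d'_def by (simp add: algebra_simps)
      have "ninv d' = Suc (ninv d)" "ninv d' \<le> count_list d' False * count_list d' True"
        using ninv_swap[of A B] ninv_le[of d'] by (simp_all add: d d'_def)
      moreover have cnt: "count_list d' False = count_list d False" "count_list d' True = count_list d True"
        by (simp_all add: d d'_def)
      ultimately have "count_list d' False * count_list d' True - ninv d'
          < count_list d False * count_list d True - ninv d"
        unfolding cnt by linarith
      moreover have "length d' = length e" "count_list d' True = count_list e True"
        using less(2,3) cnt by (simp_all add: d d'_def)
      ultimately have "in_vZv (kl_prod (zero_labels e) d' - basisv e d')"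
        by (rule less(1))
      then have v: "in_vZv (vv * kl_prod (zero_labels e) d')"
        by (rule in_vZv_vv_mult) (simp add: basisv_def)
      show ?thesis
      proof (cases "x \<and> \<not> y")
        case True
        have "in_vZv (kl_prod (zero_labels (A2 @ B2)) (A @ B) - basisv (A2 @ B2) (A @ B))"
          using less(2,3) True by (intro shorter) (simp_all add: d e)
        \<comment> \<open>Both sequences have + - at the same place, so deleting it does not change
          whether they are equal.\<close>
        moreover have "basisv (A2 @ B2) (A @ B) = basisv e d"
          using True len by (auto simp: basisv_def d e)
        ultimately show ?thesis
          using in_vZv_diff[OF _ v] True by (fastforce simp: eq algebra_simps)
      next
        case False
        have "basisv e d = 0" using False len by (auto simp: basisv_def d e)
        then show ?thesis using in_vZv_diff[OF in_vZv_0 v] False unfolding eq if_not_P[OF False] by simp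
      qed
    qed
  qed
qed

section \<open>The boundary path of a partition\<close>

lemma swp_append: "swp (Suc (length A)) (A @ x # y # B) = A @ y # x # B"
  by (simp add: swp_def nth_append list_update_append)

lemma split_at_pair:
  assumes "Suc p < length d"
  obtains A x y B where "d = A @ x # y # B" "length A = p"
proof -
  have "length d = p + (length d - p - 2) + 2" using assms by simp
  from split_two[OF this] that show thesis by blast
qed

lemma Eset_swap: "A @ x # y # B \<in> Eset n k \<longleftrightarrow> A @ y # x # B \<in> Eset n k"
  by (auto simp: Eset_def)

lemma finite_Eset: "finite (Eset n k)"
proof (rule finite_subset)
  show "Eset n k \<subseteq> {xs. set xs \<subseteq> UNIV \<and> length xs = n}" by (auto simp: Eset_def)
qed (rule finite_lists_length_eq, simp)

lemma swp_in_Eset: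
  assumes "Suc p < n" "d \<in> Eset n k"
  shows "swp (Suc p) d \<in> Eset n k" "swp (Suc p) (swp (Suc p) d) = d"
proof -
  from assms have "Suc p < length d" by (simp add: Eset_def)
  then obtain A x y B where "d = A @ x # y # B" "length A = p" by (rule split_at_pair)
  with assms(2) swp_append[of A x y B] swp_append[of A y x B]
  show "swp (Suc p) d \<in> Eset n k" "swp (Suc p) (swp (Suc p) d) = d"
    by (auto simp: Eset_swap)
qed

section \<open>The action of T_i in Temperley-Lieb form\<close>

lemma Tact_eq:
  assumes "Suc p < n"
  shows "Tact n k (Suc p) m d = (if d \<in> Eset n k then tlgen p m d - inverse vv * m d else 0)"
proof (cases "d \<in> Eset n k")
  case False
  have "Tcoef (Suc p) e d = 0" if "e \<in> Eset n k" for e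
    using that False swp_in_Eset(1)[OF assms that] by (auto simp: Tcoef_def)
  then show ?thesis using False by (simp add: Tact_def)
next
  case True
  then have "Suc p < length d" using assms by (simp add: Eset_def)
  then obtain A x y B where d: "d = A @ x # y # B" "length A = p" by (rule split_at_pair)
  define d' where "d' = A @ y # x # B"
  have swp: "swp (Suc p) d = d'" "swp (Suc p) d' = d"
    using swp_append[of A x y B] swp_append[of A y x B] d by (simp_all add: d'_def)
  have d': "d' \<in> Eset n k" using True d Eset_swap by (simp add: d'_def)
  \<comment> \<open>The diagonal matrix entry of T_i at d; the only other entry contributing to d is
    1, from the swapped sequence, when the two signs differ.\<close>
  define a where "a = (if x then if y then - inverse vv else 0 else if y then vv - inverse vv else - inverse vv)"
  have coef: "m e * Tcoef (Suc p) e d = (if e = d' then if x = y then 0 else m e else 0) + (if e = d then a * m e else 0)"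
    if "e \<in> Eset n k" for e
  proof -
    have "d = swp (Suc p) e \<longleftrightarrow> e = d'" using swp swp_in_Eset(2)[OF assms that] by auto
    moreover have "d ! p = x" "d ! Suc p = y" "d' ! p = y" "d' ! Suc p = x"
      using d by (auto simp: d'_def nth_append)
    moreover have "d = d' \<longleftrightarrow> x = y" using d by (auto simp: d'_def)
    ultimately show ?thesis
      by (cases "e = d"; cases "e = d'"; cases x; cases y) (auto simp: Tcoef_def a_def algebra_simps)
  qed
  have "Tact n k (Suc p) m d = (\<Sum>e\<in>Eset n k. (if e = d' then if x = y then 0 else m e else 0) + (if e = d then a * m e else 0))"
    unfolding Tact_def by (rule sum.cong[OF refl coef])
  also have "\<dots> = (if x = y then 0 else m d') + a * m d"
    using d' True finite_Eset by (simp add: sum.distrib)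
  also have "\<dots> = tlgen p m d - inverse vv * m d"
    using tlgen_swap[of A m x y B] d by (auto simp: d'_def a_def algebra_simps)
  finally show ?thesis using True by simp
qed

lemma tlgen_inM: "inM n k m \<Longrightarrow> d \<notin> Eset n k \<Longrightarrow> tlgen p m d = 0"
proof (cases "Suc p < length d")
  case True
  then obtain A x y B where d: "d = A @ x # y # B" "length A = p" by (rule split_at_pair)
  assume "inM n k m" "d \<notin> Eset n k"
  then show ?thesis using Eset_swap[of A x y B n k] tlgen_swap[of A m x y B] d by (auto simp: inM_def)
qed (simp add: tlgen_short)

lemma rmat_inM: "inM n k m \<Longrightarrow> inM n k (rmat p r m)"
  using tlgen_inM by (auto simp: inM_def rmat_def)

lemma Tact_rmat:
  assumes "Suc p < n" "inM n k m"
  shows "(\<lambda>d. Tact n k (Suc p) m d - vv ^ r / qint r * m d) = rmat p r m"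
proof
  fix d
  show "Tact n k (Suc p) m d - vv ^ r / qint r * m d = rmat p r m d"
    using assms tlgen_inM[OF assms(2)]
    by (cases "d \<in> Eset n k") (auto simp: Tact_eq rmat_def spec_def inM_def algebra_simps)
qed

lemma kl_prod_inM: "map fst s \<in> Eset n k \<Longrightarrow> inM n k (kl_prod s)"
proof (induction s rule: kl_prod_induct)
  case (base s)
  then show ?case by (auto simp: kl_prod_base basisv_def inM_def)
next
  case (corner A p q z B)
  then show ?case
    using kl_prod_corner[of A p q B] Eset_swap[of "map fst A" True False "map fst B"]
    by (simp add: rmat_inM)
qed

definition box_step :: "nat \<Rightarrow> nat \<Rightarrow> nat list \<Rightarrow> nat \<times> nat \<Rightarrow> vec \<Rightarrow> vec" where
  "box_step n k lam = (\<lambda>(i, j) x. (\<lambda>d. Tact n k (k + j - i) x d - (vv ^ rr lam i j / qint (rr lam i j)) * x d))"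

text \<open>Invariant for adding boxes one by one. The operators and the word of w_lambda are run
  together, so that at the end both are described by the same path.\<close>

definition reaches :: "nat \<Rightarrow> nat \<Rightarrow> nat list \<Rightarrow> (nat \<times> nat) list \<Rightarrow> lpath \<Rightarrow> bool" where
  "reaches n k lam bs s \<longleftrightarrow>
     fold (box_step n k lam) bs (basisv (one_seq n k)) = kl_prod s \<and>
     fold swp (map (\<lambda>(i, j). k + j - i) bs) (one_seq n k) = map fst s \<and> map fst s \<in> Eset n k"

lemma reaches_snoc:
  assumes "reaches n k lam bs (A @ (True, rr lam i j) # (False, rr lam i j) # B)"
    and "k + j - i = Suc (length A)" "in_diag lam i j"
  shows "reaches n k lam (bs @ [(i, j)]) (A @ (False, rr lam (Suc i) j) # (True, rr lam i (Suc j)) # B)"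
proof -
  define s where "s = A @ (True, rr lam i j) # (False, rr lam i j) # B"
  have s: "fold (box_step n k lam) bs (basisv (one_seq n k)) = kl_prod s"
    "fold swp (map (\<lambda>(i, j). k + j - i) bs) (one_seq n k) = map fst s" "map fst s \<in> Eset n k"
    using assms(1) by (auto simp: reaches_def s_def)
  \<comment> \<open>The recursion for r_ij is the rule for labels at a corner, which is why labels
    of boxes not yet added are carried along.\<close>
  have rr: "rr lam i j = Suc (max (rr lam (Suc i) j) (rr lam i (Suc j)))"
    using assms(3) rr.simps[of lam i j] by (simp add: max.commute)
  have "length s = n" using s(3) by (simp add: Eset_def)
  then have "Suc (length A) < n" by (simp add: s_def)
  then have "box_step n k lam (i, j) (kl_prod s) = rmat (length A) (rr lam i j) (kl_prod s)"
    using Tact_rmat[of "length A" n k "kl_prod s" "rr lam i j"] s(3)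
    by (simp add: box_step_def assms(2) kl_prod_inM del: times_divide_eq_left)
  also have "\<dots> = kl_prod (A @ (False, rr lam (Suc i) j) # (True, rr lam i (Suc j)) # B)"
    unfolding kl_prod_corner[of A "rr lam (Suc i) j"] rr[symmetric] s_def ..
  finally show ?thesis
    using s assms(2) swp_append[of "map fst A" True False "map fst B"]
      Eset_swap[of "map fst A" True False "map fst B"]
    by (simp add: reaches_def s_def)
qed

lemma rr_eq_0: "\<not> in_diag lam i j \<Longrightarrow> rr lam i j = 0"
  by (simp add: rr.simps)

text \<open>The part of the boundary path before row a is filled: the unmoved rows k, ..., a, then the bottom
  edges of the c columns met by row a.\<close>

definition before_row :: "nat \<Rightarrow> nat list \<Rightarrow> nat \<Rightarrow> nat \<Rightarrow> lpath" where
  "before_row k lam a c =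
     map (\<lambda>i. (True, rr lam i 1)) (rev [a..<Suc k]) @ map (\<lambda>j. (False, rr lam a j)) [1..<Suc c]"

text \<open>Adding row a moves its True step to the right. Each bottom edge that it passes then
  borders row a + 1 instead of row a. Here c is the number of columns that row a meets, and T is the
  finished part of the path.\<close>

lemma reaches_row:
  assumes "reaches n k lam bs (before_row k lam a c @ T)"
    and a: "1 \<le> a" "a \<le> length lam" "length lam \<le> k" and c: "lam ! (a - 1) \<le> c"
  shows "j \<le> lam ! (a - 1) \<Longrightarrow> reaches n k lam (bs @ map (\<lambda>j. (a, j)) [1..<j + 1])
    (before_row k lam (Suc a) j @ (True, rr lam a (Suc j)) # map (\<lambda>j. (False, rr lam a j)) [Suc j..<Suc c] @ T)"
proof (induction j)
  case 0
  have "rev [a..<Suc k] = rev [Suc a..<Suc k] @ [a]" using a by (simp add: upt_rec[of a])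
  with assms(1) show ?case by (simp add: before_row_def)
next
  case (Suc j)
  have "[Suc j..<Suc c] = Suc j # [Suc (Suc j)..<Suc c]" using Suc c by (simp add: upt_rec[of "Suc j"])
  then have "reaches n k lam (bs @ map (\<lambda>j. (a, j)) [1..<j + 1])
    (before_row k lam (Suc a) j @ (True, rr lam a (Suc j)) # (False, rr lam a (Suc j)) #
       map (\<lambda>j. (False, rr lam a j)) [Suc (Suc j)..<Suc c] @ T)"
    using Suc by simp
  moreover have "k + Suc j - a = Suc (length (before_row k lam (Suc a) j))"
    using a by (simp add: before_row_def del: upt_Suc)
  moreover have "in_diag lam a (Suc j)" using Suc a by (simp add: in_diag_def)
  ultimately have "reaches n k lam ((bs @ map (\<lambda>j. (a, j)) [1..<j + 1]) @ [(a, Suc j)])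
    (before_row k lam (Suc a) j @ (False, rr lam (Suc a) (Suc j)) # (True, rr lam a (Suc (Suc j))) #
       map (\<lambda>j. (False, rr lam a j)) [Suc (Suc j)..<Suc c] @ T)"
    by (rule reaches_snoc)
  then show ?case by (simp add: before_row_def)
qed

lemma one_seq_in_Eset: "k \<le> n \<Longrightarrow> one_seq n k \<in> Eset n k"
proof -
  have "count_list (replicate m True) True = m" "count_list (replicate m False) True = 0" for m
    by (induction m) simp_all
  then show "k \<le> n \<Longrightarrow> ?thesis" by (simp add: Eset_def one_seq_def)
qed

lemma reaches_rows:
  assumes "k \<le> n" "young lam" "fits n k lam"
  shows "a \<le> length lam \<Longrightarrow> \<exists>T. (\<forall>x\<in>set T. snd x = 0) \<and>
    reaches n k lam (concat (map (\<lambda>i. map (\<lambda>j. (i, j)) [1..<lam ! (i - 1) + 1]) [1..<a + 1]))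
      (before_row k lam (Suc a) (if a = 0 then n - k else lam ! (a - 1)) @ T)"
proof (induction a)
  case 0
  define s where "s = before_row k lam 1 (n - k)"
  have fst_s: "map fst s = one_seq n k"
    by (simp add: s_def before_row_def one_seq_def comp_def map_replicate_const del: upt_Suc)
  \<comment> \<open>Without a corner the product is the bare basis vector, although the labels along
    the empty diagram are the nonzero first-row and first-column parameters when \<open>lam\<close>
    is nonempty.\<close>
  have "s \<noteq> A @ (False, p) # (True, q) # B" for A p q B
  proof
    assume "s = A @ (False, p) # (True, q) # B"
    then have eq: "one_seq n k = map fst A @ False # True # map fst B" using fst_s by simp
    have "one_seq n k ! length A = False" "one_seq n k ! Suc (length A) = True"
      unfolding eq by (simp_all add: nth_append)
    moreover have "Suc (length A) < length (one_seq n k)" unfolding eq by simp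
    ultimately show False by (auto simp: one_seq_def nth_append split: if_splits)
  qed
  then have "kl_prod s = basisv (one_seq n k)" by (simp add: kl_prod_base fst_s)
  then have "reaches n k lam [] s" using fst_s one_seq_in_Eset assms(1) by (simp add: reaches_def)
  then show ?case by (intro exI[of _ "[]"]) (simp add: s_def)
next
  case (Suc a)
  define c where "c = (if a = 0 then n - k else lam ! (a - 1))"
  define bs where "bs = concat (map (\<lambda>i. map (\<lambda>j. (i, j)) [1..<lam ! (i - 1) + 1]) [1..<a + 1])"
  obtain T where T: "\<forall>x\<in>set T. snd x = 0" "reaches n k lam bs (before_row k lam (Suc a) c @ T)"
    using Suc unfolding c_def bs_def by auto
  have "lam ! a \<in> set lam" using Suc.prems by simp
  have "lam ! a \<le> c"
  proof (cases a)
    case 0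
    then show ?thesis using assms(3) \<open>lam ! a \<in> set lam\<close> by (simp add: c_def fits_def)
  next
    case (Suc a')
    then show ?thesis using assms(2) Suc.prems by (simp add: c_def young_def sorted_wrt_iff_nth_less)
  qed
  define T' where "T' = (True, rr lam (Suc a) (Suc (lam ! a))) # map (\<lambda>j. (False, rr lam (Suc a) j)) [Suc (lam ! a)..<Suc c] @ T"
  have "reaches n k lam (bs @ map (\<lambda>j. (Suc a, j)) [1..<lam ! a + 1])
      (before_row k lam (Suc (Suc a)) (lam ! a) @ T')"
    using reaches_row[OF T(2), of "lam ! a"] Suc.prems assms(3) \<open>lam ! a \<le> c\<close>
    by (simp add: fits_def T'_def del: upt_Suc)
  moreover have "concat (map (\<lambda>i. map (\<lambda>j. (i, j)) [1..<lam ! (i - 1) + 1]) [1..<Suc a + 1]) =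
      bs @ map (\<lambda>j. (Suc a, j)) [1..<lam ! a + 1]"
    by (simp add: bs_def upt_Suc_append[of "Suc 0" "Suc a"] del: upt_Suc)
  \<comment> \<open>The edges that row a + 1 leaves behind border boxes outside
    \<open>lam\<close>.\<close>
  moreover have "\<forall>x\<in>set T'. snd x = 0"
    using T(1) by (auto simp: T'_def in_diag_def intro!: rr_eq_0)
  ultimately show ?case by (intro exI[of _ T']) (simp del: upt_Suc)
qed

lemma X_act_kl_prod:
  assumes "k \<le> n" "young lam" "fits n k lam"
  defines "e \<equiv> perm_act (w_lam k lam) (one_seq n k)"
  shows "X_act n k lam (basisv (one_seq n k)) = kl_prod (zero_labels e)" "e \<in> Eset n k"
proof -
  obtain T c where T: "\<forall>x\<in>set T. snd x = 0" "reaches n k lam (boxes lam) (before_row k lam (Suc (length lam)) c @ T)"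
    using reaches_rows[OF assms(1-3), of "length lam"] unfolding boxes_def by blast
  define s where "s = before_row k lam (Suc (length lam)) c @ T"
  have "\<forall>x\<in>set s. snd x = 0"
    using T(1) by (auto simp: s_def before_row_def in_diag_def intro!: rr_eq_0)
  then have "zero_labels (map fst s) = s" by (induction s) auto
  moreover have "e = map fst s"
    using T(2) unfolding e_def by (simp add: reaches_def perm_act_def w_lam_def foldr_conv_fold s_def)
  ultimately show "X_act n k lam (basisv (one_seq n k)) = kl_prod (zero_labels e)" "e \<in> Eset n k"
    using T(2) by (simp_all add: reaches_def s_def X_act_def box_step_def)
qed

section \<open>The bar map\<close>

lemma Tact_lin:
  "Tact n k i (\<lambda>e. a * f e + b * h e) = (\<lambda>d. a * Tact n k i f d + b * Tact n k i h d)"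
  by (rule ext) (simp add: Tact_def sum_distrib_left sum.distrib algebra_simps)

lemma word_act_lin:
  "word_act n k w (\<lambda>e. a * f e + b * h e) = (\<lambda>d. a * word_act n k w f d + b * word_act n k w h d)"
  by (induction w) (simp_all add: Tact_lin)

lemma word_act_append: "word_act n k (u @ w) m = word_act n k u (word_act n k w m)"
  by (induction u) simp_all

section \<open>Braid relations on M\<close>

lemma tlgen_same: "tlgen p (tlgen p m) d = (vv + inverse vv) * tlgen p m d"
  by (induction p m d rule: tlgen.induct) (simp_all add: algebra_simps)

lemma tlgen_braid:
  assumes "p + 2 < length d"
  shows "tlgen p (tlgen (Suc p) (tlgen p m)) d = tlgen p m d"
    and "tlgen (Suc p) (tlgen p (tlgen (Suc p) m)) d = tlgen (Suc p) m d"
proof -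
  have "tlgen p (tlgen (Suc p) (tlgen p m)) d = tlgen p m d \<and>
    tlgen (Suc p) (tlgen p (tlgen (Suc p) m)) d = tlgen (Suc p) m d"
    using assms
  proof (induction p arbitrary: m d)
    case 0
    then obtain x y z B where "d = x # y # z # B"
      by (cases d; cases "tl d"; cases "tl (tl d)") auto
    then show ?case by (cases x; cases y; cases z) (simp_all add: algebra_simps)
  next
    case (Suc p)
    then show ?case by (cases d) simp_all
  qed
  then show "tlgen p (tlgen (Suc p) (tlgen p m)) d = tlgen p m d"
    "tlgen (Suc p) (tlgen p (tlgen (Suc p) m)) d = tlgen (Suc p) m d" by auto
qed

text \<open>T without the cutoff to E, so that products can be expanded by linearity;
  \<open>hgen_Eset\<close> makes the cutoff harmless.\<close>

definition hgen :: "nat \<Rightarrow> vec \<Rightarrow> vec" where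
  "hgen p m = (\<lambda>d. tlgen p m d - inverse vv * m d)"

lemma hgen_Eset: "d \<in> Eset n k \<Longrightarrow> (\<And>e. e \<in> Eset n k \<Longrightarrow> f e = h e) \<Longrightarrow> hgen p f d = hgen p h d"
proof (cases "Suc p < length d")
  case True
  then obtain A x y B where d: "d = A @ x # y # B" "length A = p" by (rule split_at_pair)
  assume "d \<in> Eset n k" "\<And>e. e \<in> Eset n k \<Longrightarrow> f e = h e"
  then show ?thesis
    using Eset_swap[of A x y B n k] tlgen_swap[of A f x y B] tlgen_swap[of A h x y B] d
    by (cases x; cases y) (simp_all add: hgen_def)
qed (simp add: hgen_def tlgen_short)

lemma Tact_hgen:
  "Suc p < n \<Longrightarrow> Tact n k (Suc p) m = (\<lambda>d. if d \<in> Eset n k then hgen p m d else 0)"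
  by (simp add: fun_eq_iff Tact_eq hgen_def)

text \<open>After expansion, U_p^2 = [2] U_p and U_p U_{p+1} U_p = U_p leave an expression symmetric
  in the two generators.\<close>

lemma Tact_braid:
  assumes "1 \<le> i" "Suc i < n"
  shows "Tact n k i (Tact n k (Suc i) (Tact n k i m)) = Tact n k (Suc i) (Tact n k i (Tact n k (Suc i) m))"
proof -
  obtain p where p: "i = Suc p" using assms by (cases i) auto
  have restr: "hgen a (\<lambda>d. if d \<in> Eset n k then f d else 0) d = hgen a f d" if "d \<in> Eset n k" for a f d
    by (rule hgen_Eset[OF that]) simp
  have restr2: "hgen a (hgen b (\<lambda>d. if d \<in> Eset n k then f d else 0)) d = hgen a (hgen b f) d" if "d \<in> Eset n k" for a b f d
    by (rule hgen_Eset[OF that]) (simp add: restr)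
  have "hgen p (hgen (Suc p) (hgen p m)) d = hgen (Suc p) (hgen p (hgen (Suc p) m)) d" if "d \<in> Eset n k" for d
  proof -
    have "p + 2 < length d" using that assms p by (simp add: Eset_def)
    from tlgen_braid[OF this, of m] show ?thesis
      by (simp add: hgen_def tlgen_lin tlgen_same algebra_simps)
  qed
  then show ?thesis using assms unfolding p
    by (intro ext) (simp add: Tact_hgen restr restr2 cong: if_cong)
qed

lemma Tact_commute:
  assumes "1 \<le> i" "i + 2 \<le> j" "j < n"
  shows "Tact n k i (Tact n k j m) = Tact n k j (Tact n k i m)"
proof -
  obtain p q where pq: "i = Suc p" "j = Suc q" using assms by (cases i; cases j) auto
  have restr: "hgen a (\<lambda>d. if d \<in> Eset n k then f d else 0) d = hgen a f d" if "d \<in> Eset n k" for a f d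
    by (rule hgen_Eset[OF that]) simp
  have "hgen p (hgen q m) d = hgen q (hgen p m) d" for d
    using tlgen_far_commute[of p q m d] assms pq by (simp add: hgen_def tlgen_lin algebra_simps)
  then show ?thesis using assms unfolding pq
    by (intro ext) (simp add: Tact_hgen restr cong: if_cong)
qed

lemma word_act_commute:
  "(\<And>j. j \<in> set w \<Longrightarrow> 1 \<le> j \<and> j < n \<and> (j + 2 \<le> i \<or> i + 2 \<le> j)) \<Longrightarrow> 1 \<le> i \<Longrightarrow> i < n \<Longrightarrow>
   word_act n k w (Tact n k i m) = Tact n k i (word_act n k w m)"
proof (induction w)
  case (Cons j w)
  then have "1 \<le> j" "j < n" "j + 2 \<le> i \<or> i + 2 \<le> j" by auto
  then have "Tact n k j (Tact n k i x) = Tact n k i (Tact n k j x)" for x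
    using Tact_commute[of i j n k x] Tact_commute[of j i n k x] Cons.prems(2,3) by auto
  moreover have "word_act n k w (Tact n k i m) = Tact n k i (word_act n k w m)"
    using Cons.prems by (intro Cons.IH) auto
  ultimately show ?case by simp
qed simp

section \<open>Conjugation by the longest element\<close>

lemma word_act_up_shift:
  assumes "1 \<le> i" "i < m" "m < n"
  shows "word_act n k [1..<Suc m] (Tact n k i x) = Tact n k (Suc i) (word_act n k [1..<Suc m] x)"
proof -
  have "[1..<Suc m] = [1..<i] @ [i, Suc i] @ [i + 2..<Suc m]"
    using assms upt_add_eq_append[of 1 i "Suc m - i"] by (simp add: upt_conv_Cons del: upt_Suc)
  then have split: "word_act n k [1..<Suc m] y =
      word_act n k [1..<i] (Tact n k i (Tact n k (Suc i) (word_act n k [i + 2..<Suc m] y)))" for y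
    by (simp add: word_act_append del: upt_Suc)
  have "word_act n k [i + 2..<Suc m] (Tact n k i x) = Tact n k i (word_act n k [i + 2..<Suc m] x)"
    using assms by (intro word_act_commute) auto
  moreover have "word_act n k [1..<i] (Tact n k (Suc i) y) = Tact n k (Suc i) (word_act n k [1..<i] y)" for y
    using assms by (intro word_act_commute) auto
  ultimately show ?thesis
    using assms by (simp only: split Tact_braid[of i n])
qed

lemma word_act_down_shift:
  assumes "1 \<le> i" "i < m" "m < n"
  shows "word_act n k (rev [1..<Suc m]) (Tact n k (Suc i) x) = Tact n k i (word_act n k (rev [1..<Suc m]) x)"
proof -
  have "[1..<Suc m] = [1..<i] @ [i, Suc i] @ [i + 2..<Suc m]"
    using assms upt_add_eq_append[of 1 i "Suc m - i"] by (simp add: upt_conv_Cons del: upt_Suc)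
  then have split: "word_act n k (rev [1..<Suc m]) y =
      word_act n k (rev [i + 2..<Suc m]) (Tact n k (Suc i) (Tact n k i (word_act n k (rev [1..<i]) y)))" for y
    by (simp add: word_act_append del: upt_Suc)
  have "word_act n k (rev [i + 2..<Suc m]) (Tact n k i y) = Tact n k i (word_act n k (rev [i + 2..<Suc m]) y)" for y
    using assms by (intro word_act_commute) auto
  moreover have "word_act n k (rev [1..<i]) (Tact n k (Suc i) x) = Tact n k (Suc i) (word_act n k (rev [1..<i]) x)"
    using assms by (intro word_act_commute) auto
  ultimately show ?thesis
    using assms by (simp only: split Tact_braid[of i n, symmetric])
qed

fun longest_word :: "nat \<Rightarrow> nat list" where
  "longest_word 0 = []"
| "longest_word (Suc m) = [1..<Suc (Suc m)] @ longest_word m"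

lemma set_longest_word: "set (longest_word m) \<subseteq> {1..m}"
  by (induction m) auto

text \<open>A second factorization of the longest element, needed in
  \<open>longest_word_conj\<close> for the top generator, which the upward shift does not
  reach.\<close>

lemma longest_word_alt:
  "Suc m < n \<Longrightarrow> word_act n k (longest_word (Suc m)) x = word_act n k (longest_word m) (word_act n k (rev [1..<Suc (Suc m)]) x)"
proof (induction m arbitrary: x)
  case (Suc m)
  have "[1..<Suc (Suc (Suc m))] = [1..<Suc (Suc m)] @ [Suc (Suc m)]" by simp
  then have "word_act n k (longest_word (Suc (Suc m))) x =
      word_act n k [1..<Suc (Suc m)] (Tact n k (Suc (Suc m)) (word_act n k (longest_word (Suc m)) x))"
    by (simp add: word_act_append del: upt_Suc longest_word.simps(2) add: longest_word.simps(2)[of "Suc m"])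
  also have "word_act n k (longest_word (Suc m)) x = word_act n k (longest_word m) (word_act n k (rev [1..<Suc (Suc m)]) x)"
    using Suc by simp
  also have "Tact n k (Suc (Suc m)) (word_act n k (longest_word m) (word_act n k (rev [1..<Suc (Suc m)]) x)) =
      word_act n k (longest_word m) (Tact n k (Suc (Suc m)) (word_act n k (rev [1..<Suc (Suc m)]) x))"
    using set_longest_word[of m] Suc.prems by (intro word_act_commute[symmetric]) auto
  also have "Tact n k (Suc (Suc m)) (word_act n k (rev [1..<Suc (Suc m)]) x) = word_act n k (rev [1..<Suc (Suc (Suc m))]) x"
    by simp
  finally show ?case by (simp add: word_act_append del: upt_Suc)
qed simp

lemma longest_word_conj:
  "1 \<le> i \<Longrightarrow> i \<le> m \<Longrightarrow> m < n \<Longrightarrow>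
   word_act n k (longest_word m) (Tact n k i x) = Tact n k (Suc m - i) (word_act n k (longest_word m) x)"
proof (induction m arbitrary: i x)
  case (Suc m)
  show ?case
  proof (cases "i \<le> m")
    case True
    then have "word_act n k (longest_word (Suc m)) (Tact n k i x) =
        word_act n k [1..<Suc (Suc m)] (Tact n k (Suc m - i) (word_act n k (longest_word m) x))"
      using Suc by (simp add: word_act_append del: upt_Suc)
    also have "\<dots> = Tact n k (Suc (Suc m - i)) (word_act n k [1..<Suc (Suc m)] (word_act n k (longest_word m) x))"
      using Suc.prems True by (intro word_act_up_shift) auto
    finally show ?thesis using True by (simp add: word_act_append Suc_diff_le del: upt_Suc)
  next
    case False
    then have i: "i = Suc m" using Suc.prems by simp
    show ?thesis
    proof (cases m)
      case 0
      then show ?thesis by (simp add: i)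
    next
      case m: (Suc m')
      have "word_act n k (longest_word (Suc m)) (Tact n k i x) =
          word_act n k (longest_word m) (Tact n k m (word_act n k (rev [1..<Suc (Suc m)]) x))"
        unfolding longest_word_alt[OF Suc.prems(3)] i
        using Suc.prems m by (subst word_act_down_shift) auto
      also have "\<dots> = Tact n k 1 (word_act n k (longest_word (Suc m)) x)"
        unfolding longest_word_alt[OF Suc.prems(3)] using Suc.IH[of m] Suc.prems m by simp
      finally show ?thesis by (simp add: i)
    qed
  qed
qed simp

lemma Tact_basisv: "e \<in> Eset n k \<Longrightarrow> Tact n k i (basisv e) = Tcoef i e"
  by (intro ext) (simp add: Tact_def basisv_def finite_Eset if_distrib[of "\<lambda>x. x * _"] cong: if_cong)

lemma Tact_basisv_descent:
  assumes "A @ x # y # B \<in> Eset n k" "\<not> (\<not> x \<and> y)"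
  shows "Tact n k (Suc (length A)) (basisv (A @ x # y # B)) =
    (\<lambda>d. (if x = y then - inverse vv else 1) * basisv (A @ y # x # B) d)"
  using assms unfolding Tact_basisv[OF assms(1)]
  by (intro ext) (auto simp: Tcoef_def swp_append basisv_def nth_append)

lemma word_act_scale: "word_act n k w (\<lambda>e. a * f e) = (\<lambda>d. a * word_act n k w f d)"
  using word_act_lin[of n k w a f 0 f] by simp

text \<open>By the condition on P the sign x never moves left past a - as a +, so each step only
  rescales a basis vector.\<close>

lemma word_act_up_basisv:
  "P @ x # Q \<in> Eset n k \<Longrightarrow> (x \<Longrightarrow> \<forall>y\<in>set P. y) \<Longrightarrow>
   \<exists>c. c \<noteq> 0 \<and> word_act n k [1..<Suc (length P)] (basisv (P @ x # Q)) = (\<lambda>d. c * basisv (x # P @ Q) d)"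
proof (induction P arbitrary: Q rule: rev_induct)
  case Nil
  then show ?case by (intro exI[of _ 1]) simp
next
  case (snoc y P)
  define a where "a = (if y = x then - inverse vv else 1)"
  have "Tact n k (Suc (length P)) (basisv (P @ y # x # Q)) = (\<lambda>d. a * basisv (P @ x # y # Q) d)"
    unfolding a_def using snoc.prems by (intro Tact_basisv_descent) auto
  moreover have "P @ x # (y # Q) \<in> Eset n k" using snoc.prems(1) Eset_swap[of P y x Q] by simp
  then obtain c where "c \<noteq> 0"
    "word_act n k [1..<Suc (length P)] (basisv (P @ x # y # Q)) = (\<lambda>d. c * basisv (x # P @ y # Q) d)"
    using snoc.IH snoc.prems(2) by (metis Un_iff set_append)
  ultimately show ?case
    by (intro exI[of _ "a * c"]) (simp add: word_act_append word_act_scale a_def mult.assoc)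
qed

lemma longest_word_one_seq:
  "k \<le> n \<Longrightarrow> Suc m \<le> n \<Longrightarrow> \<exists>c. c \<noteq> 0 \<and> word_act n k (longest_word m) (basisv (one_seq n k)) =
    (\<lambda>d. c * basisv (rev (take (Suc m) (one_seq n k)) @ drop (Suc m) (one_seq n k)) d)"
proof (induction m)
  case 0
  then have "rev (take (Suc 0) (one_seq n k)) = take (Suc 0) (one_seq n k)"
    by (cases "one_seq n k") auto
  then show ?case by (intro exI[of _ 1]) (simp only: append_take_drop_id, simp)
next
  case (Suc m)
  define s where "s = one_seq n k"
  have len: "length s = n" using Suc.prems by (simp add: s_def one_seq_def)
  define P where "P = rev (take (Suc m) s)"
  define x where "x = s ! Suc m"
  define Q where "Q = drop (Suc (Suc m)) s"
  obtain c where c: "c \<noteq> 0" "word_act n k (longest_word m) (basisv s) = (\<lambda>d. c * basisv (P @ drop (Suc m) s) d)"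
    using Suc unfolding s_def P_def by auto
  have drop: "drop (Suc m) s = x # Q" using Suc.prems len by (simp add: x_def Q_def Cons_nth_drop_Suc)
  have "s \<in> Eset n k" using one_seq_in_Eset Suc.prems by (simp add: s_def)
  then have "take (Suc m) s @ x # Q \<in> Eset n k" using drop by (metis append_take_drop_id)
  then have E: "P @ x # Q \<in> Eset n k" by (simp add: P_def Eset_def)
  have "\<forall>y\<in>set P. y" if x
    using that Suc.prems by (auto simp: P_def x_def s_def one_seq_def nth_append in_set_conv_nth split: if_splits)
  with E obtain c' where c': "c' \<noteq> 0"
    "word_act n k [1..<Suc (length P)] (basisv (P @ x # Q)) = (\<lambda>d. c' * basisv (x # P @ Q) d)"
    using word_act_up_basisv by blast
  have "length P = Suc m" using Suc.prems len by (simp add: P_def)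
  moreover have "x # P = rev (take (Suc (Suc m)) s)"
    using Suc.prems len by (simp add: P_def x_def take_Suc_conv_app_nth)
  ultimately have "word_act n k (longest_word (Suc m)) (basisv s) =
      (\<lambda>d. (c * c') * basisv (rev (take (Suc (Suc m)) s) @ drop (Suc (Suc m)) s) d)"
    using c c' drop by (simp add: word_act_append word_act_scale Q_def mult.assoc del: upt_Suc flip: append_Cons)
  then show ?case using c(1) c'(1) unfolding s_def by (intro exI[of _ "c * c'"]) simp
qed

lemma Tinv_act_swap:
  assumes "A @ a # b # B \<in> Eset n k"
  shows "Tinv_act n k (Suc (length A)) m (A @ a # b # B) =
    (if a = b then - vv * m (A @ a # b # B)
     else m (A @ b # a # B) + (if a then inverse vv - vv else 0) * m (A @ a # b # B))"
proof -
  have "Suc (length A) < n" using assms by (simp add: Eset_def)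
  then show ?thesis using assms by (auto simp: Tinv_act_def Tact_eq tlgen_swap algebra_simps)
qed

text \<open>
  The action of the longest element conjugates the i-th generator into the (n-i)-th one, and so does
  reversing the positions, up to inverting and barring; their composition descends to the bar map.
\<close>

lemma bar_map_exists:
  assumes "1 \<le> k" "k \<le> n - 1"
  obtains \<beta> where
    "\<And>a b f h. \<beta> (\<lambda>d. a * f d + b * h d) = (\<lambda>d. qbar a * \<beta> f d + qbar b * \<beta> h d)"
    "\<And>i m. 1 \<le> i \<Longrightarrow> i < n \<Longrightarrow> \<beta> (Tact n k i m) = Tinv_act n k i (\<beta> m)"
    "\<beta> (basisv (one_seq n k)) = basisv (one_seq n k)"
proof -
  define L where "L = word_act n k (longest_word (n - 1))"
  have n: "1 < n" "k \<le> n" using assms by auto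
  have len: "length (one_seq n k) = n" using n by (simp add: one_seq_def)
  obtain c where c: "c \<noteq> 0" "L (basisv (one_seq n k)) = (\<lambda>d. c * basisv (rev (one_seq n k)) d)"
    using longest_word_one_seq[of k n "n - 1"] n len by (auto simp: L_def)
  \<comment> \<open>Division by c makes the starting sequence fixed, and \<open>rev\<close> undoes
    the reversal caused by L.\<close>
  define \<beta> where "\<beta> m = (\<lambda>d. if d \<in> Eset n k then qbar (inverse c * L m (rev d)) else 0)" for m
  show thesis
  proof (rule that[of \<beta>])
    show "\<beta> (\<lambda>d. a * f d + b * h d) = (\<lambda>d. qbar a * \<beta> f d + qbar b * \<beta> h d)" for a b f h
      by (intro ext) (simp add: \<beta>_def L_def word_act_lin qbar_add qbar_mult algebra_simps)
    show "\<beta> (basisv (one_seq n k)) = basisv (one_seq n k)"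
      using c one_seq_in_Eset[OF n(2)] by (intro ext) (auto simp: \<beta>_def basisv_def)
    show "\<beta> (Tact n k i m) = Tinv_act n k i (\<beta> m)" if i: "1 \<le> i" "i < n" for i m
    proof
      fix d
      show "\<beta> (Tact n k i m) d = Tinv_act n k i (\<beta> m) d"
      proof (cases "d \<in> Eset n k")
        case False
        obtain p where "i = Suc p" using i by (cases i) auto
        then show ?thesis using False i by (simp add: \<beta>_def Tinv_act_def Tact_eq)
      next
        case True
        then have "length d = n" by (simp add: Eset_def)
        then have "Suc (i - 1) < length d" using i by simp
        then obtain A a b B where d: "d = A @ a # b # B" "length A = i - 1" by (rule split_at_pair)
        have i': "i = Suc (length A)" "n - i = Suc (length (rev B))" "Suc (length B) < n"
          using d i \<open>length d = n\<close> by auto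
        define d' where "d' = A @ b # a # B"
        have E: "d' \<in> Eset n k" "rev B @ b # a # rev A \<in> Eset n k"
          using True d Eset_swap[of A a b B] by (auto simp: d'_def Eset_def)
        have revd: "rev d = rev B @ b # a # rev A" "rev d' = rev B @ a # b # rev A" by (simp_all add: d d'_def)
        have "L (Tact n k i m) = Tact n k (n - i) (L m)"
          using longest_word_conj[of i "n - 1" n k m] i by (simp add: L_def)
        then have "L (Tact n k i m) (rev d) = tlgen (length (rev B)) (L m) (rev B @ b # a # rev A) - inverse vv * L m (rev d)"
          using E i'(3) unfolding i'(2) revd by (simp add: Tact_eq)
        also have "\<dots> = (if a = b then - inverse vv * L m (rev d)
            else L m (rev d') + (if a then vv - inverse vv else 0) * L m (rev d))"
          unfolding tlgen_swap revd by (auto simp: algebra_simps)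
        \<comment> \<open>Reversal moves the diagonal entry v - 1/v from - + to + -, and conjugation
          negates it; this is the matrix of the inverse of T_i.\<close>
        finally have "\<beta> (Tact n k i m) d = (if a = b then - vv * \<beta> m d
            else \<beta> m d' + (if a then inverse vv - vv else 0) * \<beta> m d)"
          using True E by (simp add: \<beta>_def qbar_mult qbar_add qbar_diff qbar_minus qbar_inverse algebra_simps)
        also have "\<dots> = Tinv_act n k i (\<beta> m) d"
          using Tinv_act_swap[of A a b B n k "\<beta> m"] True unfolding i'(1) d(1) d'_def by simp
        finally show ?thesis .
      qed
    qed
  qed
qed

section \<open>Generation of M by the starting sequence\<close>

lemma h_act_Cons: "h_act n k ((c, w) # h) m d = c * word_act n k w m d + h_act n k h m d"
  by (simp add: h_act_def)

lemma hbar_act_Cons: "hbar_act n k ((c, w) # h) m d = qbar c * word_bar_act n k w m d + hbar_act n k h m d"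
  by (simp add: hbar_act_def)

lemma h_act_Nil: "h_act n k [] m = (\<lambda>_. 0)" "hbar_act n k [] m = (\<lambda>_. 0)"
  by (simp_all add: h_act_def hbar_act_def)

definition generated :: "nat \<Rightarrow> nat \<Rightarrow> vec \<Rightarrow> bool" where
  "generated n k m \<longleftrightarrow> (\<exists>h. valid_h n h \<and> m = h_act n k h (basisv (one_seq n k)))"

lemma h_act_append: "h_act n k (h @ h') m d = h_act n k h m d + h_act n k h' m d"
  by (simp add: h_act_def)

lemma h_act_scale: "h_act n k (map (\<lambda>(c, w). (a * c, w)) h) m d = a * h_act n k h m d"
  by (induction h) (auto simp: h_act_Cons h_act_Nil algebra_simps)

lemma h_act_Tact: "h_act n k (map (\<lambda>(c, w). (c, i # w)) h) m = Tact n k i (h_act n k h m)"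
proof (induction h)
  case Nil
  then show ?case by (simp add: h_act_Nil) (simp add: Tact_def)
next
  case (Cons x h)
  obtain c w where x: "x = (c, w)" by (cases x)
  have "h_act n k (x # h) m = (\<lambda>d. c * word_act n k w m d + 1 * h_act n k h m d)"
    by (rule ext) (simp add: x h_act_Cons)
  then have Tact: "Tact n k i (h_act n k (x # h) m) =
      (\<lambda>d. c * Tact n k i (word_act n k w m) d + 1 * Tact n k i (h_act n k h m) d)"
    by (simp only: Tact_lin)
  show ?case unfolding Tact Cons.IH[symmetric] by (intro ext) (simp add: x h_act_Cons)
qed

lemma generated_lin:
  assumes "generated n k f" "generated n k h"
  shows "generated n k (\<lambda>d. a * f d + b * h d)"
proof -
  obtain u w where u: "valid_h n u" "f = h_act n k u (basisv (one_seq n k))"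
    and w: "valid_h n w" "h = h_act n k w (basisv (one_seq n k))"
    using assms by (auto simp: generated_def)
  show ?thesis unfolding generated_def
    by (rule exI[of _ "map (\<lambda>(c, w). (a * c, w)) u @ map (\<lambda>(c, w). (b * c, w)) w"])
      (use u w in \<open>auto simp: valid_h_def h_act_append h_act_scale\<close>)
qed

lemma generated_Tact:
  assumes "generated n k m" "1 \<le> i" "i < n" shows "generated n k (Tact n k i m)"
proof -
  obtain u where u: "valid_h n u" "m = h_act n k u (basisv (one_seq n k))"
    using assms by (auto simp: generated_def)
  show ?thesis unfolding generated_def
  proof (intro exI conjI)
    show "valid_h n (map (\<lambda>(c, w). (c, i # w)) u)" using u(1) assms by (fastforce simp: valid_h_def)
  qed (simp add: u h_act_Tact)
qed

lemma generated_one: "generated n k (basisv (one_seq n k))"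
  unfolding generated_def
  by (rule exI[of _ "[(1, [])]"]) (auto simp: valid_h_def h_act_Cons h_act_Nil)

lemma ascent_or_one_seq:
  assumes "e \<in> Eset n k"
  obtains (ascent) A B where "e = A @ False # True # B" | (one) "e = one_seq n k"
proof -
  from bool_list_cases[of "map Not e"] show thesis
  proof cases
    case (peak A B)
    have "e = map Not (map Not e)" by (simp add: comp_def)
    then have "e = map Not A @ False # True # map Not B" unfolding peak by simp
    then show thesis by (rule ascent)
  next
    case (top a b)
    have "e = map Not (map Not e)" by (simp add: comp_def)
    then have e: "e = replicate a True @ replicate b False" unfolding top by simp
    have "count_list (replicate m True) True = m" "count_list (replicate m False) True = 0" for m
      by (induction m) simp_all
    then have "a = k" "a + b = n" using assms by (auto simp: e Eset_def)
    then show thesis using e one by (auto simp: one_seq_def)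
  qed
qed

lemma Tact_basisv_peak:
  assumes "A @ False # True # B \<in> Eset n k"
  shows "Tact n k (Suc (length A)) (basisv (A @ True # False # B)) = basisv (A @ False # True # B)"
  using Tact_basisv_descent[of A True False B n k] assms Eset_swap[of A True False B n k] by simp

lemma generated_basisv: "e \<in> Eset n k \<Longrightarrow> generated n k (basisv e)"
proof (induction "ninv e" arbitrary: e rule: less_induct)
  case less
  from less(2) show ?case
  proof (cases rule: ascent_or_one_seq)
    case (ascent A B)
    have "generated n k (basisv (A @ True # False # B))"
      using less(2) Eset_swap[of A True False B n k] by (intro less(1)) (simp_all add: ascent ninv_swap)
    then have "generated n k (Tact n k (Suc (length A)) (basisv (A @ True # False # B)))"
      using less(2) by (intro generated_Tact) (auto simp: ascent Eset_def)
    then show ?thesis using Tact_basisv_peak[of A B n k] less(2) ascent by simp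
  next
    case one
    then show ?thesis by (simp add: generated_one)
  qed
qed

lemma inM_expand:
  assumes "inM n k m" shows "m = (\<lambda>d. \<Sum>e\<in>Eset n k. m e * basisv e d)"
  using assms finite_Eset[of n k]
  by (intro ext) (auto simp: inM_def basisv_def if_distrib[of "\<lambda>x. _ * x"] cong: if_cong)

lemma generated_inM:
  assumes "inM n k m" shows "generated n k m"
proof -
  have "generated n k (\<lambda>d. \<Sum>e\<in>S. m e * basisv e d)" if "S \<subseteq> Eset n k" "finite S" for S
    using that(2,1)
  proof (induction S)
    case empty
    then show ?case using generated_lin[OF generated_one generated_one, of n k 0 0] by simp
  next
    case (insert e S)
    then show ?case
      using generated_lin[OF generated_basisv[of e n k], of "\<lambda>d. \<Sum>e\<in>S. m e * basisv e d" "m e" 1] by simp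
  qed
  then have "generated n k (\<lambda>d. \<Sum>e\<in>Eset n k. m e * basisv e d)" using finite_Eset by simp
  then show ?thesis using inM_expand[OF assms] by simp
qed

text \<open>These three properties determine the map on everything generated by the starting
  sequence, hence on M.\<close>

locale bar_map =
  fixes n k :: nat and \<beta> :: "vec \<Rightarrow> vec"
  assumes semilinear: "\<beta> (\<lambda>d. a * f d + b * h d) = (\<lambda>d. qbar a * \<beta> f d + qbar b * \<beta> h d)"
    and Tact: "1 \<le> i \<Longrightarrow> i < n \<Longrightarrow> \<beta> (Tact n k i m) = Tinv_act n k i (\<beta> m)"
    and bar_one: "\<beta> (basisv (one_seq n k)) = basisv (one_seq n k)"
begin

lemma word_act: "set w \<subseteq> {1..<n} \<Longrightarrow> \<beta> (word_act n k w m) = word_bar_act n k w (\<beta> m)"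
  by (induction w) (simp_all add: Tact)

lemma zero: "\<beta> (\<lambda>_. 0) = (\<lambda>_. 0)"
  using semilinear[of 0 "\<lambda>_. 0" 0 "\<lambda>_. 0"] by simp

lemma h_act: "valid_h n h \<Longrightarrow> \<beta> (h_act n k h (basisv (one_seq n k))) = hbar_act n k h (basisv (one_seq n k))"
proof (induction h)
  case Nil
  then show ?case by (simp add: h_act_Nil zero)
next
  case (Cons x h)
  define m where "m = basisv (one_seq n k)"
  obtain c w where x: "x = (c, w)" by (cases x)
  have v: "valid_h n h" "set w \<subseteq> {1..<n}" using Cons.prems by (auto simp: valid_h_def x)
  have "\<beta> (h_act n k (x # h) m) = \<beta> (\<lambda>d. c * word_act n k w m d + 1 * h_act n k h m d)"
    by (rule arg_cong[of _ _ \<beta>], rule ext) (simp add: x h_act_Cons)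
  also have "\<dots> = hbar_act n k (x # h) m"
    unfolding semilinear using Cons.IH[OF v(1)] word_act[OF v(2), of m] bar_one
    by (intro ext) (simp add: x hbar_act_Cons m_def)
  finally show ?case by (simp add: m_def)
qed

text \<open>Existence of a representation is generation of M; independence of it holds because
  \<beta> sends every h 1 to bar(h) 1.\<close>

lemma barM_eq:
  assumes "inM n k m" shows "barM n k m = \<beta> m"
proof -
  obtain h where h: "valid_h n h" "m = h_act n k h (basisv (one_seq n k))"
    using generated_inM[OF assms] by (auto simp: generated_def)
  show ?thesis unfolding barM_def
  proof (rule the_equality)
    show "\<exists>h. valid_h n h \<and> m = h_act n k h (basisv (one_seq n k)) \<and> \<beta> m = hbar_act n k h (basisv (one_seq n k))"
      using h h_act by auto
  qed (use h_act in auto)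
qed

text \<open>Unitriangularity: bar of e is e plus sequences with fewer inversions. Write e as T_i e'
  with one inversion less; the inverse of T_i raises inversions by at most one.\<close>

lemma basisv_triangular:
  "e \<in> Eset n k \<Longrightarrow> d \<in> Eset n k \<Longrightarrow> ninv e \<le> ninv d \<Longrightarrow> \<beta> (basisv e) d = basisv e d"
proof (induction "ninv e" arbitrary: e d rule: less_induct)
  case less
  from less(2) show ?case
  proof (cases rule: ascent_or_one_seq)
    case (ascent A B)
    define e' where "e' = A @ True # False # B"
    have e': "e' \<in> Eset n k" "ninv e = Suc (ninv e')"
      using less(2) Eset_swap[of A True False B n k] by (simp_all add: ascent e'_def ninv_swap)
    have "Suc (length A) < length d" using less(2,3) by (simp add: Eset_def ascent)
    then obtain C x y D where d: "d = C @ x # y # D" "length C = length A" by (rule split_at_pair)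
    have IH: "\<beta> (basisv e') c = basisv e' c" if "c \<in> Eset n k" "ninv e' \<le> ninv c" for c
      using e' that by (intro less(1)) simp_all
    have "d \<noteq> e'" using e' less(4) by auto
    then have 0: "\<beta> (basisv e') d = 0" using IH[of d] less(3,4) e' by (simp add: basisv_def)
    have 1: "\<beta> (basisv e') (C @ y # x # D) = basisv e' (C @ y # x # D)"
      using less(3,4) e' ninv_swap_le[of C x y D] Eset_swap[of C x y D n k] by (intro IH) (simp_all add: d)
    have "\<beta> (basisv e) d = Tinv_act n k (Suc (length C)) (\<beta> (basisv e')) d"
      using Tact[of "Suc (length A)" "basisv e'"] Tact_basisv_peak[of A B n k] less(2)
      by (auto simp: ascent e'_def Eset_def d(2))
    also have "\<dots> = (if x = y then 0 else basisv e' (C @ y # x # D))"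
      using Tinv_act_swap[of C x y D n k "\<beta> (basisv e')"] less(3) 0 1
      by (cases x; cases y) (simp_all add: d(1))
    also have "\<dots> = basisv e d"
      using d(2) by (auto simp: basisv_def e'_def d(1) ascent)
    finally show ?thesis .
  next
    case one
    then show ?thesis by (simp add: bar_one)
  qed
qed

lemma sum: "finite S \<Longrightarrow> \<beta> (\<lambda>d. \<Sum>e\<in>S. a e * f e d) = (\<lambda>d. \<Sum>e\<in>S. qbar (a e) * \<beta> (f e) d)"
proof (induction S rule: finite_induct)
  case (insert e S)
  then show ?case using semilinear[of "a e" "f e" 1 "\<lambda>d. \<Sum>e\<in>S. a e * f e d"] by simp
qed (simp add: zero)

text \<open>At a sequence with most inversions in the support, unitriangularity makes the
  coefficient itself bar invariant, so it is 0.\<close>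

lemma fixed_in_vZv_eq_0:
  assumes "inM n k m" "\<beta> m = m" "\<And>e. e \<in> Eset n k \<Longrightarrow> in_vZv (m e)"
  shows "m = (\<lambda>_. 0)"
proof (rule ccontr)
  assume "m \<noteq> (\<lambda>_. 0)"
  define S where "S = {e \<in> Eset n k. m e \<noteq> 0}"
  have S: "finite S" "S \<noteq> {}"
    using finite_Eset \<open>m \<noteq> (\<lambda>_. 0)\<close> assms(1) by (auto simp: S_def inM_def fun_eq_iff)
  then have "Max (ninv ` S) \<in> ninv ` S" by simp
  then obtain e where "e \<in> S" "ninv e = Max (ninv ` S)" by auto
  then have e: "e \<in> Eset n k" "m e \<noteq> 0"
    and max: "\<And>e'. e' \<in> Eset n k \<Longrightarrow> m e' \<noteq> 0 \<Longrightarrow> ninv e' \<le> ninv e"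
    using S by (auto simp: S_def)
  have "m e = \<beta> m e" using assms(2) by simp
  also have "\<dots> = (\<Sum>e'\<in>Eset n k. qbar (m e') * \<beta> (basisv e') e)"
    using sum[OF finite_Eset, of m basisv n k] inM_expand[OF assms(1)] by metis
  also have "\<dots> = (\<Sum>e'\<in>Eset n k. if e' = e then qbar (m e) else 0)"
  proof (rule sum.cong[OF refl])
    fix e' assume "e' \<in> Eset n k"
    then show "qbar (m e') * \<beta> (basisv e') e = (if e' = e then qbar (m e) else 0)"
      using basisv_triangular[of e' e] max[of e'] e(1) by (cases "m e' = 0") (auto simp: basisv_def)
  qed
  also have "\<dots> = qbar (m e)" using e finite_Eset by simp
  finally show False using qbar_fixed_in_vZv[of "m e"] assms(3) e by simp
qed

lemma rmat_fixed:
  assumes "inM n k m" "Suc p < n" "0 < r" "\<beta> m = m"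
  shows "\<beta> (rmat p r m) = rmat p r m"
proof -
  define a where "a = inverse vv - spec r"
  have rmat: "rmat p r m = (\<lambda>d. 1 * Tact n k (Suc p) m d + a * m d)"
  proof
    fix d show "rmat p r m d = 1 * Tact n k (Suc p) m d + a * m d"
      using assms(1,2) tlgen_inM[of n k m d p] by (auto simp: Tact_eq rmat_def a_def inM_def algebra_simps)
  qed
  have a: "qbar a = vv - spec r" using assms(3) by (simp add: a_def qbar_diff qbar_spec qbar_inverse)
  then show ?thesis
    unfolding rmat semilinear a using assms by (intro ext) (simp add: Tact Tinv_act_def a_def algebra_simps)
qed

lemma kl_prod_fixed: "map fst s \<in> Eset n k \<Longrightarrow> \<beta> (kl_prod s) = kl_prod s"
proof (induction s rule: kl_prod_induct)
  case (base s)
  from base(2) have "map fst s = one_seq n k"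
  proof (cases rule: ascent_or_one_seq)
    case (ascent A B)
    then obtain A' x y B' where "s = A' @ x # y # B'" "fst x = False" "fst y = True"
      by (auto simp: map_eq_append_conv map_eq_Cons_conv)
    then show ?thesis using base(1) by (metis prod.collapse)
  qed
  then show ?case using base by (simp add: kl_prod_base bar_one)
next
  case (corner A p q z B)
  define s' where "s' = A @ (True, z) # (False, z) # B"
  have s': "map fst s' \<in> Eset n k"
    using corner(3) Eset_swap[of "map fst A" True False "map fst B" n k] by (simp add: s'_def)
  then have "Suc (length A) < n" by (simp add: s'_def Eset_def)
  then have "\<beta> (rmat (length A) z (kl_prod s')) = rmat (length A) z (kl_prod s')"
    using corner s' by (intro rmat_fixed kl_prod_inM) (simp_all add: s'_def)
  then show ?case using kl_prod_corner[of A p q B] corner(1) by (simp add: s'_def)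
qed

end

theorem mainTheorem2:
  fixes n k :: nat and lam :: "nat list"
  assumes "1 \<le> k" and "k \<le> n - 1"
    and "young lam" and "fits n k lam"
  shows "X_act n k lam (basisv (one_seq n k)) = CJ n k (w_lam k lam)"
proof -
  obtain \<beta> where \<beta>:
    "\<And>a b f h. \<beta> (\<lambda>d. a * f d + b * h d) = (\<lambda>d. qbar a * \<beta> f d + qbar b * \<beta> h d)"
    "\<And>i m. 1 \<le> i \<Longrightarrow> i < n \<Longrightarrow> \<beta> (Tact n k i m) = Tinv_act n k i (\<beta> m)"
    "\<beta> (basisv (one_seq n k)) = basisv (one_seq n k)"
    using bar_map_exists[OF assms(1,2)] by blast
  interpret bar_map n k \<beta> by unfold_locales (rule \<beta>; assumption)+
  define e where "e = perm_act (w_lam k lam) (one_seq n k)"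
  define X where "X = kl_prod (zero_labels e)"
  have X: "X_act n k lam (basisv (one_seq n k)) = X" and e: "e \<in> Eset n k"
    using X_act_kl_prod[of k n lam] assms by (simp_all add: X_def e_def)
  have fst_e: "map fst (zero_labels e) = e" by (simp add: comp_def)
  have inM_X: "inM n k X" unfolding X_def by (rule kl_prod_inM) (simp only: fst_e e)
  have fix_X: "\<beta> X = X" unfolding X_def by (rule kl_prod_fixed) (simp only: fst_e e)
  have lattice_X: "in_vZv (X d - basisv e d)" if "d \<in> Eset n k" for d
    using kl_prod_lattice[of d e] that e by (simp add: X_def Eset_def)
  show ?thesis
    unfolding X CJ_def
  proof (rule the_equality[symmetric])
    show "inM n k X \<and> barM n k X = X \<and> (\<forall>d\<in>Eset n k. in_vZv (X d - basisv (perm_act (w_lam k lam) (one_seq n k)) d))"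
      using inM_X fix_X lattice_X barM_eq[OF inM_X] by (simp flip: e_def)
  next
    fix m
    assume m: "inM n k m \<and> barM n k m = m \<and> (\<forall>d\<in>Eset n k. in_vZv (m d - basisv (perm_act (w_lam k lam) (one_seq n k)) d))"
    \<comment> \<open>The difference of two candidates, written with scalars so that
      \<open>semilinear\<close> applies.\<close>
    define D where "D = (\<lambda>d. 1 * m d + (- 1) * X d)"
    have "\<beta> m = m" using m barM_eq by auto
    then have "\<beta> D = D" unfolding D_def semilinear using fix_X by (simp add: qbar_minus)
    moreover have "inM n k D" using m inM_X by (simp add: D_def inM_def)
    moreover have "in_vZv (D d)" if "d \<in> Eset n k" for d
      using in_vZv_diff[of "m d - basisv e d" "X d - basisv e d"] lattice_X[OF that] m that
      by (simp add: D_def flip: e_def)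
    ultimately have "D = (\<lambda>_. 0)" by (intro fixed_in_vZv_eq_0)
    then have "m d - X d = 0" for d by (simp add: D_def fun_eq_iff)
    then show "m = X" by (simp add: fun_eq_iff)
  qed
qed

end
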